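(* Let $m>1$ and $n\ge1$ be integers. For $i\in\{1,\dots,m\}$ let $A_i\in\mathbb{R}^{n_i\times n}$ have full column rank and let $b_i\in\mathbb{R}^{n_i}$; let $A$ be the matrix obtained by stacking $A_1,\dots,A_m$ and $b$ the vector obtained by stacking $b_1,\dots,b_m$ (the equation $Ax=b$ need not have a solution). Let $\mathbb{T}$ be a tree graph with vertex set $\{1,\dots,m\}$, oriented arbitrarily, let $H$ be its $m\times(m-1)$ incidence matrix, and let $h_i$ be the $i$th row of $H$. Let $I$ be the $n\times n$ identity and set $$M_i=\begin{bmatrix}A_i^\top A_i & h_i\otimes I\end{bmatrix}\in\mathbb{R}^{n\times mn},\qquad M=\begin{bmatrix}M_1\\ \vdots\\ M_m\end{bmatrix},\qquad q=\begin{bmatrix}A_1^\top b_1\\ \vdots\\ A_m^\top b_m\end{bmatrix}.$$ Then: (i) the equation $M\bar x=q$, with $\bar x=[x^\top\ y_1^\top\ \cdots\ y_{m-1}^\top]^\top$ and $x,y_1,\dots,y_{m-1}\in\mathbb{R}^n$, has a solution, and the sub-vector $x$ of any solution satisfies $A^\top Ax=A^\top b$; (ii) let $\bar P_i$ be the orthogonal projection matrix onto $\ker M_i$, let $\mathbb{N}(t)$, $t\ge1$, be a repeatedly jointly strongly connected sequence of neighbor graphs with neighbor sets $\mathcal{N}_i(t)$, let $m_i(t)$ be the number of elements of $\mathcal{N}_i(t)$, and let $\bar x_i(t)=[x_i(t)^\top\ x_{i1}(t)^\top\cdots x_{i(m-1)}(t)^\top]^\top\in\mathbb{R}^{mn}$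 satisfy $M_i\bar x_i(1)=A_i^\top b_i$ and $$\bar x_i(t+1)=\bar x_i(t)-\frac1{m_i(t)}\bar P_i\Bigl(m_i(t)\bar x_i(t)-\sum_{j\in\mathcal{N}_i(t)}\bar x_j(t)\Bigr),\qquad t\ge1,\ i\in\{1,\dots,m\}.$$ Then all of the sub-vectors $x_i(t)\in\mathbb{R}^n$ converge exponentially fast, as $t\to\infty$, to the least squares solution of $Ax=b$.
   Context: The least squares solution to $Ax=b$ is the $x$ with $A^\top Ax=A^\top b$ (unique here since $A$ has full column rank). The incidence matrix of an oriented graph has one row per vertex and one column per arc; each column has exactly one entry $+1$ and one entry $-1$, in the rows of the two endpoints of the arc, and all other entries $0$. $\otimes$ is the Kronecker product. "Exponentially fast" means that there are constants $c$ and $0<\lambda<1$ such that the norm of the error at time $t$ is at most $c\lambda^t$ for all $t\ge1$. Neighbor graphs: there are $m$ agents labelled $1,\dots,m$. At each time $t$ agent $i$ has a set of neighbors $\mathcal{N}_i(t)\subset\{1,\dots,m\}$ with $i\in\mathcal{N}_i(t)$ always. $\mathbb{N}(t)$ is the directed graph on $\{1,\dots,m\}$ with an arc from $j$ to $i$ exactly when $j\in\mathcal{N}_i(t)$. $\mathcal{G}_{sa}$ is the set of directed graphs on $\{1,\dots,m\}$ with self-arcs at all vertices. For $\mathbb{G}_p,\mathbb{G}_q\in\mathcal{G}_{sa}$ the composition $\mathbb{G}_q\circ\mathbb{G}_p\in\mathcal{G}_{sa}$ has $(i,j)$ as an arc exactly when there is a vertex $k$ such that $(i,k)$ is an arc in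 $\mathbb{G}_p$ and $(k,j)$ is an arc in $\mathbb{G}_q$; composition is associative. An infinite sequence $\mathbb{G}_1,\mathbb{G}_2,\dots$ in $\mathcal{G}_{sa}$ is repeatedly jointly strongly connected if for some positive integers $l$ and $\tau_0$ and each integer $k>0$ the composed graph $\mathbb{G}_{kl+\tau_0-1}\circ\mathbb{G}_{kl+\tau_0-2}\circ\cdots\circ\mathbb{G}_{(k-1)l+\tau_0}$ is strongly connected. *)

theory Defs
  imports
    Complex_Main
    "Jordan_Normal_Form.Matrix_Kernel"
    "Jordan_Normal_Form.DL_Rank"
    "Graph_Theory.Digraph_Component"
begin

text \<open>
  Vertices, agents, rows and columns are numbered from 0, so the vertex set is
  \<open>{..<m}\<close> instead of \<open>{1..m}\<close>. Time starts at 1.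
\<close>

subsection \<open>Block matrices\<close>

definition append_cols :: "real mat \<Rightarrow> real mat \<Rightarrow> real mat" (infixr \<open>@\<^sub>c\<close> 65) where
  "A @\<^sub>c B = four_block_mat A B (0\<^sub>m 0 (dim_col A)) (0\<^sub>m 0 (dim_col B))"

definition stack_mats :: "nat \<Rightarrow> real mat list \<Rightarrow> real mat" where
  "stack_mats nc As = foldr (@\<^sub>r) As (0\<^sub>m 0 nc)"

definition stack_vecs :: "real vec list \<Rightarrow> real vec" where
  "stack_vecs vs = foldr (@\<^sub>v) vs vNil"

definition kronecker :: "real mat \<Rightarrow> real mat \<Rightarrow> real mat" (infixl \<open>\<otimes>\<^sub>k\<close> 70) where
  "A \<otimes>\<^sub>k B = mat (dim_row A * dim_row B) (dim_col A * dim_col B)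
     (\<lambda>(i, j). A $$ (i div dim_row B, j div dim_col B) * B $$ (i mod dim_row B, j mod dim_col B))"

definition full_column_rank :: "real mat \<Rightarrow> bool" where
  "full_column_rank A \<longleftrightarrow> vec_space.rank (dim_row A) A = dim_col A"

definition least_squares_solution :: "real mat \<Rightarrow> real vec \<Rightarrow> real vec \<Rightarrow> bool" where
  "least_squares_solution A b x \<longleftrightarrow>
     x \<in> carrier_vec (dim_col A) \<and> A\<^sup>T *\<^sub>v (A *\<^sub>v x) = A\<^sup>T *\<^sub>v b"

text \<open>\<open>P\<close> is the \<open>N \<times> N\<close> matrix of the orthogonal projection onto the subspace \<open>W\<close>.\<close>

definition orth_projection_mat :: "nat \<Rightarrow> real vec set \<Rightarrow> real mat \<Rightarrow> bool" where
  "orth_projection_mat N W P \<longleftrightarrow> P \<in> carrier_mat N N \<and>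
     (\<forall>v\<in>carrier_vec N. P *\<^sub>v v \<in> W \<and> (\<forall>w\<in>W. (v - P *\<^sub>v v) \<bullet> w = 0))"

definition euclid_norm :: "real vec \<Rightarrow> real" where
  "euclid_norm v = sqrt (v \<bullet> v)"

definition converges_exponentially :: "(nat \<Rightarrow> real vec) \<Rightarrow> real vec \<Rightarrow> bool" where
  "converges_exponentially x l \<longleftrightarrow>
     (\<exists>c r. 0 < r \<and> r < 1 \<and> (\<forall>t\<ge>1. euclid_norm (x t - l) \<le> c * r ^ t))"

subsection \<open>Trees and incidence matrices\<close>

text \<open>
  As in the graph library, an undirected simple graph is a symmetric loop-free digraph
  (\<open>pair_graph\<close>), in which the walk \<open>u, v, u\<close> counts as a cycle. Cycles of the undirected graph
  are those of length at least 3. The library constant \<open>tree\<close> only excludes directed cycles,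
  so it is not usable here.
\<close>

definition tree_graph :: "'a pair_pre_digraph \<Rightarrow> bool" where
  "tree_graph G \<longleftrightarrow> pair_graph G \<and> connected (with_proj G) \<and>
     \<not> (\<exists>p. pre_digraph.cycle (with_proj G) p \<and> 3 \<le> length p)"

text \<open>\<open>D\<close> contains exactly one arc, in one of the two directions, for every edge of \<open>G\<close>.\<close>

definition orientation_of :: "('a, 'b) pre_digraph \<Rightarrow> 'a pair_pre_digraph \<Rightarrow> bool" where
  "orientation_of D G \<longleftrightarrow> wf_digraph D \<and> mk_symmetric D = G \<and>
     (\<forall>e\<in>arcs D. \<forall>f\<in>arcs D. {tail D e, head D e} = {tail D f, head D f} \<longrightarrow> e = f)"

text \<open>For vertices \<open>{..<nv}\<close> and arcs \<open>{..<na}\<close>; arc \<open>k\<close> belongs to column \<open>k\<close>.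
  Reversing arcs flips the signs of columns, so fixing \<open>+1\<close> at the head costs no generality.\<close>

definition incidence_matrix :: "nat \<Rightarrow> nat \<Rightarrow> (nat, nat) pre_digraph \<Rightarrow> real mat" where
  "incidence_matrix nv na D = mat nv na
     (\<lambda>(i, k). if i = head D k then 1 else if i = tail D k then -1 else 0)"

subsection \<open>Neighbor graphs\<close>

definition neighbor_graph :: "nat \<Rightarrow> (nat \<Rightarrow> nat set) \<Rightarrow> nat pair_pre_digraph" where
  "neighbor_graph m N = \<lparr> pverts = {..<m}, parcs = {(j, i). i < m \<and> j \<in> N i} \<rparr>"

definition graph_compose ::
    "'a pair_pre_digraph \<Rightarrow> 'a pair_pre_digraph \<Rightarrow> 'a pair_pre_digraph" (infixl \<open>\<circ>\<^sub>g\<close> 70) where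
  "Gq \<circ>\<^sub>g Gp = \<lparr> pverts = pverts Gp, parcs = {(i, j). \<exists>k. (i, k) \<in> parcs Gp \<and> (k, j) \<in> parcs Gq} \<rparr>"

text \<open>\<open>compose_window G a s\<close> is the composition of the \<open>s + 1\<close> graphs \<open>G (a + s), \<dots>, G a\<close>.\<close>

primrec compose_window :: "(nat \<Rightarrow> 'a pair_pre_digraph) \<Rightarrow> nat \<Rightarrow> nat \<Rightarrow> 'a pair_pre_digraph" where
  "compose_window G a 0 = G a"
| "compose_window G a (Suc s) = G (a + Suc s) \<circ>\<^sub>g compose_window G a s"

definition repeatedly_jointly_strongly_connected :: "(nat \<Rightarrow> 'a pair_pre_digraph) \<Rightarrow> bool" where
  "repeatedly_jointly_strongly_connected G \<longleftrightarrow>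
     (\<exists>l \<tau>0. 0 < l \<and> 0 < \<tau>0 \<and>
       (\<forall>k>0. strongly_connected (with_proj (compose_window G ((k - 1) * l + \<tau>0) (l - 1)))))"

end

(*
  Let s solve M s = q; it exists and is unique because M is square with trivial kernel: adding the
  block rows cancels H and leaves the normal equation, and H is injective because its rows other
  than the first form a square matrix with a right inverse read off from walks in the tree.
  The errors u_i(t) = z_i(t) - s lie in ker M_i and satisfy u_i(t+1) = P_i (average of u_j(t)).
  If B bounds all squared norms at time t, the deficits B - |u|^2 satisfy an exact balance in one
  step: the deficit of u_i(t+1) controls the deficits of all neighbours u_j(t) and their distances
  to u_i(t+1). Following arcs backwards through m strongly connected windows, the deficit d of one
  late error controls its distance to all m early errors u_j, up to a fixed factor. Since u_j lies
  in ker M_j and these kernels meet only in 0, |v|^2 <= C sum_j |v - u_j|^2 for every v, so the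
  late error has squared norm at most a constant times d. This is a uniform contraction.
*)
theory Submission
  imports Defs
begin

section \<open>Averaging with projections\<close>

text \<open>Vectors are modelled as functions on an index set, which keeps the averaging argument
  free of carrier conditions; \<open>self_scalar_prod_eq_sqn\<close> translates from
  vectors.\<close>

definition sqn :: "'c set \<Rightarrow> ('c \<Rightarrow> real) \<Rightarrow> real" where
  "sqn I u = (\<Sum>k\<in>I. (u k)\<^sup>2)"

lemma sqn_nonneg: "0 \<le> sqn I u"
  by (simp add: sqn_def sum_nonneg)

lemma sqn_diff_triangle:
  "sqn I (\<lambda>k. u k - w k) \<le> 2 * sqn I (\<lambda>k. u k - v k) + 2 * sqn I (\<lambda>k. v k - w k)"
proof -
  have "(u k - w k)\<^sup>2 \<le> 2 * (u k - v k)\<^sup>2 + 2 * (v k - w k)\<^sup>2" for k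
    using zero_le_power2[of "(u k - v k) - (v k - w k)"]
    by (simp add: power2_eq_square algebra_simps)
  then show ?thesis
    unfolding sqn_def sum_distrib_left sum.distrib[symmetric] by (intro sum_mono)
qed

text \<open>In each coordinate the cross term vanishes because deviations from the mean sum to zero.
  Equality matters here: the energy lost by averaging is exactly the spread of the
  \<open>u j\<close>.\<close>

lemma sqn_mean_decomposition:
  fixes u :: "'j \<Rightarrow> 'c \<Rightarrow> real"
  assumes "finite S" "S \<noteq> {}" "finite I"
  defines "w \<equiv> \<lambda>k. (\<Sum>j\<in>S. u j k) / card S"
  shows "(\<Sum>j\<in>S. sqn I (u j)) = card S * sqn I w + (\<Sum>j\<in>S. sqn I (\<lambda>k. u j k - w k))"
proof -
  have c: "real (card S) \<noteq> 0" using assms by auto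
  have "(\<Sum>j\<in>S. (u j k)\<^sup>2) = card S * (w k)\<^sup>2 + (\<Sum>j\<in>S. (u j k - w k)\<^sup>2)" for k
  proof -
    have s: "(\<Sum>j\<in>S. u j k) = card S * w k" using c by (simp add: w_def)
    have "(\<Sum>j\<in>S. (u j k - w k)\<^sup>2) = (\<Sum>j\<in>S. (u j k)\<^sup>2 - 2 * w k * u j k + (w k)\<^sup>2)"
      by (simp add: power2_eq_square algebra_simps)
    also have "\<dots> = (\<Sum>j\<in>S. (u j k)\<^sup>2) - 2 * w k * (\<Sum>j\<in>S. u j k) + card S * (w k)\<^sup>2"
      by (simp add: sum.distrib sum_subtractf sum_distrib_left)
    finally show ?thesis unfolding s by (simp add: power2_eq_square algebra_simps)
  qed
  then have "(\<Sum>k\<in>I. \<Sum>j\<in>S. (u j k)\<^sup>2)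
      = (\<Sum>k\<in>I. card S * (w k)\<^sup>2 + (\<Sum>j\<in>S. (u j k - w k)\<^sup>2))" by simp
  then show ?thesis
    unfolding sqn_def by (simp add: sum.distrib sum_distrib_left sum.swap[of _ I S])
qed

text \<open>Given a bound \<open>B\<close> on squared norms, the deficit of \<open>v\<close> controls, up to the factor \<open>K\<close>, the
  deficit of \<open>u\<close> and the distance between \<open>u\<close> and \<open>v\<close>.\<close>

definition linked :: "'c set \<Rightarrow> real \<Rightarrow> real \<Rightarrow> ('c \<Rightarrow> real) \<Rightarrow> ('c \<Rightarrow> real) \<Rightarrow> bool" where
  "linked I B K u v \<longleftrightarrow>
     B - sqn I u \<le> K * (B - sqn I v) \<and> sqn I (\<lambda>k. u k - v k) \<le> K * (B - sqn I v)"

lemma linked_mono: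
  assumes "linked I B K u v" "K \<le> K'" "sqn I v \<le> B"
  shows "linked I B K' u v"
proof -
  have "K * (B - sqn I v) \<le> K' * (B - sqn I v)" using assms by (intro mult_right_mono) auto
  then show ?thesis using assms(1) unfolding linked_def by linarith
qed

text \<open>Deficits multiply along the chain; distances are added with
  \<open>sqn_diff_triangle\<close>, whose two factors \<open>2\<close> give the \<open>4\<close>.
  The assumption \<open>1 <= K\<close> absorbs the bound \<open>K' * d\<close> on the distance
  between \<open>v\<close> and \<open>w\<close> into \<open>K * (K' * d)\<close>.\<close>

lemma linked_trans:
  assumes uv: "linked I B K u v" and vw: "linked I B K' v w" and "1 \<le> K" and "0 \<le> K'"
    and w: "sqn I w \<le> B"
  shows "linked I B (4 * K * K') u w"
proof -
  define d where "d = B - sqn I w"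
  define e where "e = B - sqn I v"
  have d: "0 \<le> d" and e: "e \<le> K' * d" "sqn I (\<lambda>k. v k - w k) \<le> K' * d"
    using vw w by (auto simp: linked_def d_def e_def)
  have u: "B - sqn I u \<le> K * e" "sqn I (\<lambda>k. u k - v k) \<le> K * e"
    using uv by (auto simp: linked_def e_def)
  have le: "K * e \<le> K * (K' * d)" using e(1) \<open>1 \<le> K\<close> by (intro mult_left_mono) auto
  have nn: "0 \<le> K' * d" using d \<open>0 \<le> K'\<close> by simp
  have one: "K' * d \<le> K * (K' * d)" using mult_right_mono[OF \<open>1 \<le> K\<close> nn] by simp
  have "B - sqn I u \<le> 4 * (K * (K' * d))" using u(1) le one nn by linarith
  moreover have "sqn I (\<lambda>k. u k - w k) \<le> 4 * (K * (K' * d))"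
    using sqn_diff_triangle[of I u w v] u(2) e(2) le one by linarith
  ultimately show ?thesis unfolding linked_def d_def by (simp add: mult.assoc)
qed

text \<open>A path from a vertex outside \<open>S\<close> to one inside must enter \<open>S\<close>
  by some arc. An entering arc is what is needed when influences are followed backwards in
  time.\<close>

lemma strongly_connected_crossing_arc:
  assumes sc: "strongly_connected (with_proj G)"
    and "S \<subseteq> pverts G" "S \<noteq> {}" "S \<noteq> pverts G"
  obtains j k where "(j, k) \<in> parcs G" "j \<in> pverts G - S" "k \<in> S"
proof -
  obtain a b where a: "a \<in> pverts G" "a \<notin> S" and b: "b \<in> S" using assms by blast
  have ab: "(a, b) \<in> rtrancl_on (pverts G) (parcs G)"
    using sc a b assms(2) by (auto simp: strongly_connected_def reachable_def)
  have "\<exists>j k. (j, k) \<in> parcs G \<and> j \<in> pverts G - S \<and> k \<in> S"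
    if "b \<in> S" using ab that
  proof (induct rule: rtrancl_on_induct)
    case base then show ?case using a by blast
  next
    case (step y z) then show ?case by (cases "y \<in> S") auto
  qed
  then show thesis using b that by blast
qed

section \<open>One step of averaging and projecting\<close>

text \<open>\<open>e t i\<close> is the error of agent \<open>i\<close> at time \<open>t\<close>.
  The projections enter only through \<open>pythagoras\<close>, which holds when the new error is
  the orthogonal projection of the neighbors' mean onto a subspace. \<open>coercive\<close> is the
  quantitative form of the fact that the subspaces containing the errors meet only in zero.\<close>

locale projected_averaging =
  fixes m :: nat and N :: "nat \<Rightarrow> nat \<Rightarrow> nat set" and I :: "'c set"
    and e :: "nat \<Rightarrow> nat \<Rightarrow> 'c \<Rightarrow> real" and C :: real
  assumes finite_I: "finite I" and m_pos: "0 < m" and C_nonneg: "0 \<le> C"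
    and neighbors: "\<And>t i. 1 \<le> t \<Longrightarrow> i < m \<Longrightarrow> N t i \<subseteq> {..<m} \<and> i \<in> N t i"
    and pythagoras: "\<And>t i. 1 \<le> t \<Longrightarrow> i < m \<Longrightarrow>
      sqn I (\<lambda>k. (\<Sum>j\<in>N t i. e t j k) / card (N t i)) = sqn I (e (Suc t) i) +
      sqn I (\<lambda>k. (\<Sum>j\<in>N t i. e t j k) / card (N t i) - e (Suc t) i k)"
    and coercive: "\<And>t v. 1 \<le> t \<Longrightarrow> sqn I v \<le> C * (\<Sum>j<m. sqn I (\<lambda>k. v k - e t j k))"
begin

text \<open>\<open>sqn_mean_decomposition\<close> followed by \<open>pythagoras\<close>, rewritten
  in terms of deficits. This is an identity for every real \<open>B\<close>; signs enter only once
  \<open>B\<close> bounds the squared norms.\<close>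

lemma energy_balance:
  fixes t i :: nat
  assumes "1 \<le> t" "i < m"
  defines "w \<equiv> \<lambda>k. (\<Sum>j\<in>N t i. e t j k) / card (N t i)"
  shows "(\<Sum>j\<in>N t i. B - sqn I (e t j)) + (\<Sum>j\<in>N t i. sqn I (\<lambda>k. e t j k - w k))
      + card (N t i) * sqn I (\<lambda>k. w k - e (Suc t) i k)
    = card (N t i) * (B - sqn I (e (Suc t) i))"
proof -
  have ne: "finite (N t i)" "N t i \<noteq> {}"
    using neighbors[OF assms(1,2)] finite_subset by auto
  show ?thesis
    using sqn_mean_decomposition[OF ne finite_I, of "e t"] pythagoras[OF assms(1,2)]
    unfolding w_def by (simp add: sum_subtractf algebra_simps)
qed

lemma sqn_step_le:
  assumes "1 \<le> t" "i < m" and B: "\<And>j. j < m \<Longrightarrow> sqn I (e t j) \<le> B"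
  shows "sqn I (e (Suc t) i) \<le> B"
proof -
  have N: "finite (N t i)" "N t i \<noteq> {}" "N t i \<subseteq> {..<m}"
    using neighbors[OF assms(1,2)] finite_subset by auto
  have "0 \<le> (\<Sum>j\<in>N t i. B - sqn I (e t j))" using B N(3) by (intro sum_nonneg) (simp add: subset_eq)
  then have "0 \<le> card (N t i) * (B - sqn I (e (Suc t) i))"
    unfolding energy_balance[OF assms(1,2), symmetric]
    by (simp add: sum_nonneg sqn_nonneg)
  then show ?thesis using N by (simp add: zero_le_mult_iff)
qed

lemma sqn_le_later:
  assumes "1 \<le> a" and B: "\<And>j. j < m \<Longrightarrow> sqn I (e a j) \<le> B" and "a \<le> t" and "i < m"
  shows "sqn I (e t i) \<le> B"
  using \<open>a \<le> t\<close> \<open>i < m\<close>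
proof (induct arbitrary: i rule: dec_induct)
  case base then show ?case using B by simp
next
  case (step t) then show ?case using sqn_step_le[of t i B] \<open>1 \<le> a\<close> by simp
qed

text \<open>All terms on the left of \<open>energy_balance\<close> are nonnegative, so each is at
  most \<open>m\<close> times the new deficit \<open>d\<close>. The deficit of \<open>e t j\<close>
  is part of them, and the distance from \<open>e t j\<close> to \<open>e (Suc t) i\<close> is split
  at the mean \<open>w\<close>, where the other terms control both pieces.\<close>

lemma linked_step:
  assumes "1 \<le> t" "i < m" "j \<in> N t i" and B: "\<And>j. j < m \<Longrightarrow> sqn I (e t j) \<le> B"
  shows "linked I B (4 * real m) (e t j) (e (Suc t) i)"
proof -
  define w where "w = (\<lambda>k. (\<Sum>j\<in>N t i. e t j k) / card (N t i))"
  define c where "c = real (card (N t i))"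
  define d where "d = B - sqn I (e (Suc t) i)"
  have N: "finite (N t i)" "N t i \<noteq> {}" "N t i \<subseteq> {..<m}"
    using neighbors[OF assms(1,2)] finite_subset by auto
  have c: "1 \<le> c" "c \<le> m"
    using N card_mono[OF _ N(3)] by (auto simp: c_def Suc_le_eq card_gt_0_iff)
  have d: "0 \<le> d" using sqn_step_le[OF assms(1,2) B] by (simp add: d_def)
  have cd: "c * d \<le> m * d" using c d by (intro mult_right_mono) auto
  let ?X = "\<Sum>j\<in>N t i. B - sqn I (e t j)" and ?Y = "\<Sum>j\<in>N t i. sqn I (\<lambda>k. e t j k - w k)"
    and ?z = "sqn I (\<lambda>k. w k - e (Suc t) i k)"
  have bal: "?X + ?Y + c * ?z = c * d"
    using energy_balance[OF assms(1,2), of B] by (simp add: w_def c_def d_def)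
  have NB: "0 \<le> B - sqn I (e t x)" if "x \<in> N t i" for x using that N(3) B by (simp add: subset_eq)
  have X: "B - sqn I (e t j) \<le> ?X" using N(1) assms(3) NB by (intro member_le_sum) auto
  have Y: "sqn I (\<lambda>k. e t j k - w k) \<le> ?Y"
    using N assms(3) by (intro member_le_sum) (auto simp: sqn_nonneg)
  have Xn: "0 \<le> ?X" using NB by (intro sum_nonneg)
  have Yn: "0 \<le> ?Y" by (intro sum_nonneg sqn_nonneg)
  have z: "?z \<le> c * ?z" using mult_right_mono[OF c(1) sqn_nonneg[of I "\<lambda>k. w k - e (Suc t) i k"]] by simp
  have zn: "0 \<le> ?z" by (rule sqn_nonneg)
  have "B - sqn I (e t j) \<le> m * d" using X Yn z zn bal cd by linarith
  moreover have "sqn I (\<lambda>k. e t j k - e (Suc t) i k) \<le> 4 * (m * d)"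
    using sqn_diff_triangle[of I "e t j" "e (Suc t) i" w] Y Xn Yn z zn bal cd by linarith
  moreover have "0 \<le> m * d" using d by simp
  ultimately show ?thesis unfolding linked_def d_def[symmetric] by simp
qed

section \<open>Linking along composed neighbor graphs\<close>

abbreviation window :: "nat \<Rightarrow> nat \<Rightarrow> nat pair_pre_digraph" where
  "window a s \<equiv> compose_window (\<lambda>t. neighbor_graph m (N t)) a s"

lemma pverts_window: "pverts (window a s) = {..<m}"
  by (induct s) (auto simp: neighbor_graph_def graph_compose_def)

lemma window_self_arc: "1 \<le> a \<Longrightarrow> i < m \<Longrightarrow> (i, i) \<in> parcs (window a s)"
proof (induct s)
  case 0 then show ?case using neighbors by (auto simp: neighbor_graph_def)
next
  case (Suc s)
  then have "(i, i) \<in> parcs (neighbor_graph m (N (a + Suc s)))"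
    using neighbors[of "a + Suc s" i] by (auto simp: neighbor_graph_def)
  then show ?case using Suc by (auto simp: graph_compose_def)
qed

text \<open>An arc of the composed graph unfolds into one neighbor relation per time step. Each step
  costs \<open>4 * m\<close> by \<open>linked_step\<close> and a further \<open>4\<close> for
  chaining, hence \<open>16 * m\<close>. The graph at time \<open>t\<close> governs the passage from
  \<open>t\<close> to \<open>Suc t\<close>, so a window from \<open>a\<close> to
  \<open>a + s\<close> reaches the errors at \<open>a + Suc s\<close>.\<close>

lemma linked_window:
  assumes "1 \<le> a" "(j, i) \<in> parcs (window a s)"
    and B: "\<And>j. j < m \<Longrightarrow> sqn I (e a j) \<le> B"
  shows "linked I B ((16 * real m) ^ Suc s) (e a j) (e (a + Suc s) i)"
  using assms(2)
proof (induct s arbitrary: i)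
  case 0
  then have i: "i < m" "j \<in> N a i" by (auto simp: neighbor_graph_def)
  show ?case using linked_step[OF \<open>1 \<le> a\<close> i B] sqn_step_le[OF \<open>1 \<le> a\<close> i(1) B]
    by (auto intro: linked_mono)
next
  case (Suc s)
  let ?t = "a + Suc s"
  obtain k where k: "(j, k) \<in> parcs (window a s)" "k \<in> N ?t i" "i < m"
    using Suc.prems by (auto simp: graph_compose_def neighbor_graph_def)
  have t: "1 \<le> ?t" using \<open>1 \<le> a\<close> by simp
  have later: "sqn I (e t' x) \<le> B" if "a \<le> t'" "x < m" for t' x
    using sqn_le_later[OF \<open>1 \<le> a\<close> B that] .
  have "linked I B (4 * real m) (e ?t k) (e (Suc ?t) i)"
    using linked_step[OF t k(3,2)] later by simp
  moreover have "(1::real) \<le> (16 * real m) ^ Suc s" using m_pos by (intro one_le_power) simp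
  ultimately have "linked I B (4 * (16 * real m) ^ Suc s * (4 * m)) (e a j) (e (Suc ?t) i)"
    using Suc.hyps[OF k(1)] later[of "Suc ?t" i] k(3) by (intro linked_trans) auto
  then show ?case by (simp add: mult_ac)
qed

text \<open>Going back one window, self-arcs keep all vertices of the linked set, and strong
  connectivity supplies an arc entering it from outside, so it gains a vertex until it is full. The
  late time stays fixed while windows are added at the early end, which is why \<open>k\<close> is
  generalized.\<close>

lemma linked_spread:
  assumes "1 \<le> \<tau>" "0 < l"
    and sc: "\<And>k. strongly_connected (with_proj (window (k * l + \<tau>) (l - 1)))"
    and B: "\<And>j. j < m \<Longrightarrow> sqn I (e (k * l + \<tau>) j) \<le> B" and "i < m"
  shows "\<exists>S\<subseteq>{..<m}. min m (Suc p) \<le> card S \<and>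
    (\<forall>j\<in>S. linked I B ((4 * (16 * real m) ^ l) ^ p) (e (k * l + \<tau>) j) (e ((k + p) * l + \<tau>) i))"
  using B
proof (induct p arbitrary: k)
  case 0
  show ?case
    using 0 \<open>i < m\<close> by (intro exI[of _ "{i}"]) (auto simp: linked_def sqn_def)
next
  case (Suc p)
  let ?a = "k * l + \<tau>" and ?b = "(k + 1) * l + \<tau>" and ?c = "(k + Suc p) * l + \<tau>"
  let ?W = "window ?a (l - 1)"
  have a: "1 \<le> ?a" using assms(1) by simp
  \<comment> \<open>A composition of \<open>l\<close> graphs is a window with parameter
    \<open>l - 1\<close>.\<close>
  have b: "?b = ?a + Suc (l - 1)" using \<open>0 < l\<close> by simp
  have later: "sqn I (e t x) \<le> B" if "?a \<le> t" "x < m" for t x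
    using sqn_le_later[OF a Suc.prems that] .
  have ab: "?a \<le> ?b" by simp
  have ac: "?a \<le> ?c" by (intro add_right_mono mult_le_mono1) simp
  from Suc.hyps[of "k + 1"] later[OF ab] obtain S where S: "S \<subseteq> {..<m}" "min m (Suc p) \<le> card S"
    "\<And>j. j \<in> S \<Longrightarrow> linked I B ((4 * (16 * real m) ^ l) ^ p) (e ?b j) (e ?c i)"
    by auto
  \<comment> \<open>The induction hypothesis links \<open>S\<close> at time \<open>?b\<close> to the
    late error; \<open>S'\<close> collects the sources of arcs into \<open>S\<close> across the
    earlier window.\<close>
  define S' where "S' = {j\<in>{..<m}. \<exists>x\<in>S. (j, x) \<in> parcs ?W}"
  have finS: "finite S" "finite S'" using S(1) finite_subset by (auto simp: S'_def)
  have sub: "S \<subseteq> S'" using S(1) window_self_arc[OF a] by (auto simp: S'_def)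
  have card: "min m (Suc (Suc p)) \<le> card S'"
  proof (cases "S = {..<m}")
    case True then show ?thesis using card_mono[OF finS(2) sub] by simp
  next
    case False
    have "S \<noteq> {}" using S(2) m_pos by auto
    then obtain j x where "(j, x) \<in> parcs ?W" "j \<in> {..<m} - S" "x \<in> S"
      using strongly_connected_crossing_arc[OF sc, of S k] S(1) False by (auto simp: pverts_window)
    then have "j \<in> S' - S" by (auto simp: S'_def)
    then have "card S < card S'" using finS sub by (intro psubset_card_mono) auto
    then show ?thesis using S(2) by linarith
  qed
  have "linked I B ((4 * (16 * real m) ^ l) ^ Suc p) (e ?a j) (e ?c i)" if j: "j \<in> S'" for j
  proof -
    obtain x where x: "x \<in> S" "(j, x) \<in> parcs ?W" using j unfolding S'_def by blast
    have "linked I B ((16 * real m) ^ l) (e ?a j) (e ?b x)"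
      using linked_window[OF a x(2) Suc.prems] b \<open>0 < l\<close> by (simp add: ac_simps)
    moreover have "(1::real) \<le> (16 * real m) ^ l" using m_pos by (intro one_le_power) simp
    ultimately have "linked I B (4 * (16 * real m) ^ l * (4 * (16 * real m) ^ l) ^ p) (e ?a j) (e ?c i)"
      using S(3)[OF x(1)] later[OF ac \<open>i < m\<close>] by (intro linked_trans) auto
    then show ?thesis by simp
  qed
  then show ?case using card by (intro exI[of _ S']) (auto simp: S'_def)
qed

section \<open>Contraction and exponential decay\<close>

text \<open>After \<open>m\<close> windows every agent is linked to the late error, so
  \<open>coercive\<close>, applied to that error itself, bounds its squared norm \<open>q\<close> by
  \<open>D * (B - q)\<close>; solving for \<open>q\<close> gives the factor. The \<open>+ 1\<close>
  in \<open>D\<close> makes \<open>D\<close> positive, so that the factor lies strictly between 0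
  and 1.\<close>

lemma contraction:
  fixes \<tau> l :: nat
  assumes "1 \<le> \<tau>" "0 < l"
    and sc: "\<And>k. strongly_connected (with_proj (window (k * l + \<tau>) (l - 1)))"
  defines "D \<equiv> C * m * (4 * (16 * real m) ^ l) ^ m + 1"
  assumes B: "\<And>j. j < m \<Longrightarrow> sqn I (e (k * l + \<tau>) j) \<le> B" and "i < m"
  shows "sqn I (e ((k + m) * l + \<tau>) i) \<le> D / (1 + D) * B"
proof -
  let ?a = "k * l + \<tau>" and ?c = "(k + m) * l + \<tau>" and ?K = "(4 * (16 * real m) ^ l) ^ m"
  have a: "1 \<le> ?a" using assms(1) by simp
  define q where "q = sqn I (e ?c i)"
  have q: "q \<le> B" unfolding q_def by (rule sqn_le_later[OF a B _ \<open>i < m\<close>]) auto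
  have D: "0 < D" using C_nonneg by (auto simp: D_def intro!: add_nonneg_pos mult_nonneg_nonneg)
  \<comment> \<open>With \<open>p = m\<close> the lower bound on the cardinality is
    \<open>m\<close>, which forces \<open>S\<close> to be the whole vertex set.\<close>
  obtain S where S: "S \<subseteq> {..<m}" "min m (Suc m) \<le> card S"
    "\<And>j. j \<in> S \<Longrightarrow> linked I B ?K (e ?a j) (e ?c i)"
    using linked_spread[where p = m, OF assms(1,2) sc B \<open>i < m\<close>] by auto
  have "S = {..<m}" using S(1,2) by (intro card_subset_eq) (auto dest: card_mono[rotated])
  then have lk: "sqn I (\<lambda>k. e ?c i k - e ?a j k) \<le> ?K * (B - q)" if "j < m" for j
    using S(3)[of j] that by (simp add: linked_def q_def sqn_def power2_commute)
  have "q \<le> C * (\<Sum>j<m. sqn I (\<lambda>k. e ?c i k - e ?a j k))"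
    unfolding q_def by (rule coercive[OF a])
  also have "\<dots> \<le> C * (\<Sum>j<m. ?K * (B - q))"
    using C_nonneg lk by (intro mult_left_mono sum_mono) auto
  also have "\<dots> \<le> D * (B - q)" using q by (simp add: D_def algebra_simps)
  finally have "q * (1 + D) \<le> D * B" by (simp add: algebra_simps)
  then show ?thesis unfolding q_def[symmetric] using D by (simp add: field_simps)
qed

text \<open>The bound shrinks by \<open>th\<close> every \<open>L = m * l\<close> steps from time
  \<open>\<tau>\<close> on; in between, and before \<open>\<tau>\<close>, bounds on the squared
  norms merely persist.\<close>

theorem exponential_decay:
  assumes rep: "repeatedly_jointly_strongly_connected (\<lambda>t. neighbor_graph m (N t))"
  shows "\<exists>c r. 0 \<le> c \<and> 0 < r \<and> r < 1 \<and> (\<forall>t\<ge>1. \<forall>i<m. sqn I (e t i) \<le> c * r ^ t)"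
proof -
  obtain l \<tau> where l: "0 < l" and \<tau>: "0 < \<tau>"
    and sc': "\<And>k. 0 < k \<Longrightarrow> strongly_connected (with_proj (window ((k - 1) * l + \<tau>) (l - 1)))"
    using rep by (auto simp: repeatedly_jointly_strongly_connected_def)
  \<comment> \<open>Windows are counted from 0 here and from 1 in the definition.\<close>
  have sc: "strongly_connected (with_proj (window (k * l + \<tau>) (l - 1)))" for k
    using sc'[of "Suc k"] by simp
  define D where "D = C * m * (4 * (16 * real m) ^ l) ^ m + 1"
  have D: "0 < D" using C_nonneg by (auto simp: D_def intro!: add_nonneg_pos mult_nonneg_nonneg)
  define th where "th = D / (1 + D)"
  have th: "0 < th" "th < 1" using D by (auto simp: th_def)
  define B where "B = (\<Sum>j<m. sqn I (e 1 j))"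
  have B0: "0 \<le> B" unfolding B_def by (intro sum_nonneg sqn_nonneg)
  have B1: "sqn I (e 1 j) \<le> B" if "j < m" for j
    unfolding B_def using that by (intro member_le_sum) (auto simp: sqn_nonneg)
  have init: "sqn I (e t i) \<le> B" if "1 \<le> t" "i < m" for t i
    using sqn_le_later[OF _ B1 that] by simp
  define L where "L = m * l"
  have L: "0 < L" using m_pos l by (simp add: L_def)
  have decay: "sqn I (e (k * L + \<tau>) i) \<le> th ^ k * B" if "i < m" for k i
    using that
  proof (induct k arbitrary: i)
    case 0 then show ?case using init \<tau> by simp
  next
    case (Suc k)
    \<comment> \<open>\<open>contraction\<close> is used from window \<open>k * m\<close> on, with
      the bound \<open>th ^ k * B\<close> reached so far.\<close>
    have "sqn I (e ((k * m + m) * l + \<tau>) i) \<le> D / (1 + D) * (th ^ k * B)"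
      unfolding D_def
      by (rule contraction) (use Suc \<tau> l sc in \<open>auto simp: L_def mult.assoc\<close>)
    then show ?case unfolding th_def L_def by (simp add: distrib_right mult_ac add_ac)
  qed
  \<comment> \<open>The rate per single step, chosen so that \<open>r ^ L = th\<close>.\<close>
  define r where "r = root L th"
  have r: "0 < r" "r < 1" "r ^ L = th" using th L by (auto simp: r_def)
  \<comment> \<open>The division compensates for the times before \<open>\<tau>\<close> and for the
    fewer than \<open>L\<close> steps since the last time at which the bound shrank.\<close>
  define c where "c = B / r ^ (\<tau> + L)"
  have "sqn I (e t i) \<le> c * r ^ t" if t: "1 \<le> t" and i: "i < m" for t i
  proof (cases "t < \<tau>")
    case True
    then have "r ^ (\<tau> + L) \<le> r ^ t" using r by (intro power_decreasing) auto
    then have "B * r ^ (\<tau> + L) \<le> B * r ^ t" using B0 by (rule mult_left_mono)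
    then have "B \<le> c * r ^ t" using r by (simp add: c_def field_simps)
    then show ?thesis using init[OF t i] by linarith
  next
    case False
    define k where "k = (t - \<tau>) div L"
    have "k * L \<le> t - \<tau>" by (simp add: k_def)
    then have le: "k * L + \<tau> \<le> t" using False by simp
    have "t - \<tau> < Suc k * L"
      unfolding k_def using L dividend_less_div_times[of L "t - \<tau>"] by simp
    then have lt: "t \<le> (\<tau> + L) + L * k" by (simp add: algebra_simps)
    have "1 \<le> k * L + \<tau>" using \<tau> by simp
    then have "sqn I (e t i) \<le> th ^ k * B" using decay le i by (rule sqn_le_later)
    also have "\<dots> = c * r ^ ((\<tau> + L) + L * k)"
      using r(1) th(1) by (simp add: c_def power_add power_mult r(3))
    also have "\<dots> \<le> c * r ^ t"
      using lt r B0 by (intro mult_left_mono power_decreasing) (auto simp: c_def)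
    finally show ?thesis .
  qed
  then show ?thesis using r B0 by (intro exI[of _ c] exI[of _ r]) (auto simp: c_def)
qed

end

section \<open>Linear algebra\<close>

lemma self_scalar_prod: "v \<in> carrier_vec d \<Longrightarrow> v \<bullet> v = (\<Sum>k<d. (v $ k)\<^sup>2)" for v :: "real vec"
  by (auto simp: scalar_prod_def atLeast0LessThan power2_eq_square)

lemma self_scalar_prod_nonneg: "0 \<le> v \<bullet> v" for v :: "real vec"
  unfolding self_scalar_prod[OF carrier_vec_dim_vec] by (simp add: sum_nonneg)

lemma self_scalar_prod_eq_0_iff:
  fixes v :: "real vec"
  assumes v: "v \<in> carrier_vec d"
  shows "v \<bullet> v = 0 \<longleftrightarrow> v = 0\<^sub>v d"
proof
  assume "v \<bullet> v = 0"
  then have "\<forall>k<d. v $ k = 0" by (simp add: self_scalar_prod[OF v] sum_nonneg_eq_0_iff)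
  then show "v = 0\<^sub>v d" using v by (intro eq_vecI) auto
qed simp

text \<open>A nonzero kernel vector is a linear dependency between the columns, contradicting full
  rank. Since independence concerns the set of columns, repetitions have to be excluded first: a
  maximal independent subset has \<open>nc\<close> elements, so that set has at least
  \<open>nc\<close>.\<close>

lemma full_column_rank_kernel:
  assumes A: "A \<in> carrier_mat nr nc" and "full_column_rank A"
    and v: "v \<in> carrier_vec nc" "A *\<^sub>v v = 0\<^sub>v nr"
  shows "v = 0\<^sub>v nc"
proof (rule ccontr)
  assume v0: "v \<noteq> 0\<^sub>v nc"
  interpret vec_space "TYPE(real)" nr .
  have rank: "rank A = nc" using assms by (auto simp: full_column_rank_def)
  have "distinct (cols A)"
  proof (rule card_distinct)
    obtain S where S: "maximal S (\<lambda>T. T \<subseteq> set (cols A) \<and> lin_indpt T)"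
      using maximal_exists[of "(\<lambda>T. T \<subseteq> set (cols A) \<and> lin_indpt T)" "card (set (cols A))" "{}"]
      by (meson List.finite_set card_mono empty_iff empty_subsetI finite_lin_indpt2 rev_finite_subset)
    then have "card S \<le> card (set (cols A))" by (simp add: card_mono maximal_def)
    then have "nc \<le> card (set (cols A))" using rank_card_indpt[OF A S] rank by simp
    then show "card (set (cols A)) = length (cols A)"
      using card_length[of "cols A"] A by simp
  qed
  then show False
    using full_rank_lin_indpt[OF A rank] lin_depI[OF A v(1) v0 v(2)] by blast
qed

lemma square_inverse_of_trivial_kernel:
  fixes A :: "real mat"
  assumes A: "A \<in> carrier_mat n n"
    and inj: "\<And>v. v \<in> carrier_vec n \<Longrightarrow> A *\<^sub>v v = 0\<^sub>v n \<Longrightarrow> v = 0\<^sub>v n"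
  obtains B where "B \<in> carrier_mat n n" "B * A = 1\<^sub>m n" "A * B = 1\<^sub>m n"
proof -
  have "det A \<noteq> 0" using inj det_0_iff_vec_prod_zero_field[OF A] by auto
  from det_non_zero_imp_unit[OF A this, of undefined] show thesis
    using that unfolding Units_def ring_mat_def by auto
qed

section \<open>Products with block, Kronecker and stacked matrices\<close>

lemma append_cols_carrier:
  "A \<in> carrier_mat nr n1 \<Longrightarrow> B \<in> carrier_mat nr n2 \<Longrightarrow> A @\<^sub>c B \<in> carrier_mat nr (n1 + n2)"
  by (auto simp: append_cols_def)

lemma append_cols_mult_vec:
  assumes A: "A \<in> carrier_mat nr n1" and B: "B \<in> carrier_mat nr n2"
    and v: "v \<in> carrier_vec (n1 + n2)"
  shows "(A @\<^sub>c B) *\<^sub>v v = A *\<^sub>v vec_first v n1 + B *\<^sub>v vec_last v n2"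
proof -
  \<comment> \<open>The two lower blocks have no rows, so the lower part of the product is the empty
    vector.\<close>
  have "(A @\<^sub>c B) *\<^sub>v (vec_first v n1 @\<^sub>v vec_last v n2)
      = (A *\<^sub>v vec_first v n1 + B *\<^sub>v vec_last v n2) @\<^sub>v
        (0\<^sub>m 0 n1 *\<^sub>v vec_first v n1 + 0\<^sub>m 0 n2 *\<^sub>v vec_last v n2)"
    unfolding append_cols_def using A B
    by (subst four_block_mat_mult_vec[of _ nr n1 _ n2 _ 0]) auto
  also have "\<dots> = A *\<^sub>v vec_first v n1 + B *\<^sub>v vec_last v n2"
    using A B by (intro eq_vecI) auto
  finally show ?thesis using v by simp
qed

lemma kronecker_row_carrier:
  "h \<in> carrier_vec p \<Longrightarrow> mat_of_row h \<otimes>\<^sub>k 1\<^sub>m n \<in> carrier_mat n (p * n)"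
  by (auto simp: kronecker_def)

text \<open>Row \<open>a\<close> of the Kronecker product is supported on the columns congruent to
  \<open>a\<close> modulo \<open>n\<close>. Grouping the columns into \<open>p\<close> blocks of
  length \<open>n\<close> leaves one term per block.\<close>

lemma kronecker_row_mult_vec:
  assumes h: "h \<in> carrier_vec p" and w: "w \<in> carrier_vec (p * n)" and a: "a < n"
  shows "((mat_of_row h \<otimes>\<^sub>k 1\<^sub>m n) *\<^sub>v w) $ a = (\<Sum>k<p. h $ k * w $ (k * n + a))"
proof -
  define f where "f c = h $ (c div n) * (if a = c mod n then 1 else 0) * w $ c" for c
  have n: "0 < n" using a by simp
  have lt: "c div n < p" if "c < p * n" for c using that n by (simp add: less_mult_imp_div_less)
  have "((mat_of_row h \<otimes>\<^sub>k 1\<^sub>m n) *\<^sub>v w) $ a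
      = (\<Sum>c<p * n. (mat_of_row h \<otimes>\<^sub>k 1\<^sub>m n) $$ (a, c) * w $ c)"
    using h w a kronecker_row_carrier[OF h, of n]
    by (auto simp: scalar_prod_def atLeast0LessThan intro!: sum.cong)
  also have "\<dots> = (\<Sum>c<p * n. f c)"
    using h a n lt by (intro sum.cong) (auto simp: kronecker_def f_def mat_of_row_def)
  also have "\<dots> = (\<Sum>k<p. sum f {k * n..<k * n + n})"
    by (rule sum.nat_group[symmetric])
  also have "\<dots> = (\<Sum>k<p. h $ k * w $ (k * n + a))"
  proof (rule sum.cong[OF refl])
    fix k
    have "sum f {k * n..<k * n + n} = sum f {k * n + a}"
    proof (rule sum.mono_neutral_right)
      show "\<forall>c\<in>{k * n..<k * n + n} - {k * n + a}. f c = 0"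
      proof
        fix c assume c: "c \<in> {k * n..<k * n + n} - {k * n + a}"
        then obtain d where d: "c = k * n + d" by (auto simp: le_iff_add)
        with c have "d < n" "d \<noteq> a" by auto
        then show "f c = 0" by (simp add: f_def d)
      qed
    qed (use a in auto)
    then show "sum f {k * n..<k * n + n} = h $ k * w $ (k * n + a)"
      using a n by (simp add: f_def)
  qed
  finally show ?thesis .
qed

lemma stack_mats_carrier:
  "(\<And>x. x \<in> set xs \<Longrightarrow> F x \<in> carrier_mat (r x) nc) \<Longrightarrow>
    stack_mats nc (map F xs) \<in> carrier_mat (\<Sum>x\<leftarrow>xs. r x) nc"
  by (induct xs) (auto simp: stack_mats_def)

lemma stack_vecs_carrier:
  "(\<And>x. x \<in> set xs \<Longrightarrow> f x \<in> carrier_vec (r x)) \<Longrightarrow>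
    stack_vecs (map f xs) \<in> carrier_vec (\<Sum>x\<leftarrow>xs. r x)"
  by (induct xs) (auto simp: stack_vecs_def)

lemma stack_mats_mult_vec:
  assumes "\<And>x. x \<in> set xs \<Longrightarrow> F x \<in> carrier_mat (r x) nc" and v: "v \<in> carrier_vec nc"
  shows "stack_mats nc (map F xs) *\<^sub>v v = stack_vecs (map (\<lambda>x. F x *\<^sub>v v) xs)"
  using assms(1)
proof (induct xs)
  case Nil
  then show ?case by (auto simp: stack_mats_def stack_vecs_def)
next
  case (Cons x xs)
  have "(F x @\<^sub>r stack_mats nc (map F xs)) *\<^sub>v v = (F x *\<^sub>v v) @\<^sub>v (stack_mats nc (map F xs) *\<^sub>v v)"
    using Cons.prems by (intro mat_mult_append[OF _ stack_mats_carrier v]) auto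
  with Cons show ?case by (simp add: stack_mats_def stack_vecs_def)
qed

lemma stack_vecs_eq_iff:
  "(\<And>x. x \<in> set xs \<Longrightarrow> f x \<in> carrier_vec (r x)) \<Longrightarrow> (\<And>x. x \<in> set xs \<Longrightarrow> g x \<in> carrier_vec (r x)) \<Longrightarrow>
    stack_vecs (map f xs) = stack_vecs (map g xs) \<longleftrightarrow> (\<forall>x\<in>set xs. f x = g x)"
proof (induct xs)
  case (Cons x xs)
  have "f x @\<^sub>v stack_vecs (map f xs) = g x @\<^sub>v stack_vecs (map g xs) \<longleftrightarrow>
      f x = g x \<and> stack_vecs (map f xs) = stack_vecs (map g xs)"
    using Cons.prems by (intro append_vec_eq[of _ "r x"]) auto
  with Cons show ?case by (simp add: stack_vecs_def)
qed simp

lemma stack_vecs_scalar_prod: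
  "(\<And>x. x \<in> set xs \<Longrightarrow> f x \<in> carrier_vec (r x)) \<Longrightarrow> (\<And>x. x \<in> set xs \<Longrightarrow> g x \<in> carrier_vec (r x)) \<Longrightarrow>
    stack_vecs (map f xs) \<bullet> stack_vecs (map g xs) = (\<Sum>x\<leftarrow>xs. f x \<bullet> g x)"
proof (induct xs)
  case (Cons x xs)
  have "(f x @\<^sub>v stack_vecs (map f xs)) \<bullet> (g x @\<^sub>v stack_vecs (map g xs)) =
      f x \<bullet> g x + stack_vecs (map f xs) \<bullet> stack_vecs (map g xs)"
    using Cons.prems by (intro scalar_prod_append[OF _ stack_vecs_carrier _ stack_vecs_carrier]) auto
  with Cons show ?case by (simp add: stack_vecs_def)
qed (simp add: stack_vecs_def scalar_prod_def)

lemma stack_mats_col: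
  "(\<And>x. x \<in> set xs \<Longrightarrow> F x \<in> carrier_mat (r x) nc) \<Longrightarrow> c < nc \<Longrightarrow>
    col (stack_mats nc (map F xs)) c = stack_vecs (map (\<lambda>x. col (F x) c) xs)"
proof (induct xs)
  case Nil
  then show ?case by (auto simp: stack_mats_def stack_vecs_def intro!: eq_vecI)
next
  case (Cons x xs)
  have F: "F x \<in> carrier_mat (r x) nc" and "stack_mats nc (map F xs) \<in> carrier_mat (\<Sum>x\<leftarrow>xs. r x) nc"
    using Cons.prems by (auto intro: stack_mats_carrier)
  then have "col (F x @\<^sub>r stack_mats nc (map F xs)) c = col (F x) c @\<^sub>v col (stack_mats nc (map F xs)) c"
    using \<open>c < nc\<close> by (intro eq_vecI) (auto simp: append_rows_def)
  with Cons show ?case by (simp add: stack_mats_def stack_vecs_def)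
qed

text \<open>Column \<open>c\<close> of a stack is the stack of the columns \<open>c\<close>, and the
  scalar product of two stacks is the sum over the blocks.\<close>

lemma stack_mats_transpose_mult_vec:
  assumes "\<And>x. x \<in> set xs \<Longrightarrow> F x \<in> carrier_mat (r x) nc"
    and "\<And>x. x \<in> set xs \<Longrightarrow> f x \<in> carrier_vec (r x)" and "c < nc"
  shows "((stack_mats nc (map F xs))\<^sup>T *\<^sub>v stack_vecs (map f xs)) $ c
    = (\<Sum>x\<leftarrow>xs. ((F x)\<^sup>T *\<^sub>v f x) $ c)"
proof -
  have col: "col (F x) c \<in> carrier_vec (r x)" if "x \<in> set xs" for x
    using assms(1)[OF that] by (intro carrier_vecI) simp
  have "((stack_mats nc (map F xs))\<^sup>T *\<^sub>v stack_vecs (map f xs)) $ c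
      = col (stack_mats nc (map F xs)) c \<bullet> stack_vecs (map f xs)"
    using stack_mats_carrier[of xs F r nc, OF assms(1)] \<open>c < nc\<close> by simp
  also have "\<dots> = stack_vecs (map (\<lambda>x. col (F x) c) xs) \<bullet> stack_vecs (map f xs)"
    by (rule arg_cong[where f = "\<lambda>v. v \<bullet> stack_vecs (map f xs)"])
      (rule stack_mats_col[of xs F r nc, OF assms(1) \<open>c < nc\<close>])
  also have "\<dots> = (\<Sum>x\<leftarrow>xs. col (F x) c \<bullet> f x)"
    by (rule stack_vecs_scalar_prod[of xs _ r, OF col assms(2)])
  also have "map (\<lambda>x. col (F x) c \<bullet> f x) xs = map (\<lambda>x. ((F x)\<^sup>T *\<^sub>v f x) $ c) xs"
  proof (rule map_cong[OF refl])
    fix x assume "x \<in> set xs"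
    then show "col (F x) c \<bullet> f x = ((F x)\<^sup>T *\<^sub>v f x) $ c"
      using assms(1)[of x] \<open>c < nc\<close> by simp
  qed
  finally show ?thesis .
qed

section \<open>Norm bounds, coercivity and projections\<close>

lemma square_add_le: "(x + y)\<^sup>2 \<le> 2 * x\<^sup>2 + 2 * y\<^sup>2" for x y :: real
  using zero_le_power2[of "x - y"] by (simp add: power2_eq_square algebra_simps)

text \<open>A crude form of the Cauchy-Schwarz inequality: only the existence of some constant
  matters, so one coordinate at a time is split off with \<open>square_add_le\<close>.\<close>

lemma linear_form_bounded:
  fixes a :: "'k \<Rightarrow> real"
  assumes "finite I"
  shows "\<exists>c\<ge>0. \<forall>v. (\<Sum>k\<in>I. a k * v k)\<^sup>2 \<le> c * (\<Sum>k\<in>I. (v k)\<^sup>2)"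
  using assms
proof induct
  case empty then show ?case by auto
next
  case (insert x I)
  then obtain c where c: "0 \<le> c" "\<And>v. (\<Sum>k\<in>I. a k * v k)\<^sup>2 \<le> c * (\<Sum>k\<in>I. (v k)\<^sup>2)" by blast
  define d where "d = 2 * c + 2 * (a x)\<^sup>2"
  have d: "2 * (a x)\<^sup>2 \<le> d" "2 * c \<le> d" using c(1) by (simp_all add: d_def)
  have "(\<Sum>k\<in>insert x I. a k * v k)\<^sup>2 \<le> d * (\<Sum>k\<in>insert x I. (v k)\<^sup>2)" for v
  proof -
    define s where "s = (\<Sum>k\<in>I. a k * v k)"
    define q where "q = (\<Sum>k\<in>I. (v k)\<^sup>2)"
    have "0 \<le> q" by (simp add: q_def sum_nonneg)
    have "(a x * v x + s)\<^sup>2 \<le> 2 * (a x)\<^sup>2 * (v x)\<^sup>2 + 2 * s\<^sup>2"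
      using square_add_le[of "a x * v x" s] by (simp add: power_mult_distrib)
    also have "\<dots> \<le> 2 * (a x)\<^sup>2 * (v x)\<^sup>2 + 2 * c * q"
      using c(2)[of v] by (simp add: s_def q_def)
    also have "\<dots> \<le> d * (v x)\<^sup>2 + d * q"
      using d \<open>0 \<le> q\<close> by (intro add_mono mult_right_mono) auto
    finally show ?thesis using insert by (simp add: s_def q_def distrib_left)
  qed
  moreover have "0 \<le> d" using c(1) by (simp add: d_def)
  ultimately show ?case by blast
qed

lemma mult_mat_vec_bounded:
  fixes A :: "real mat"
  assumes A: "A \<in> carrier_mat nr nc"
  shows "\<exists>c\<ge>0. \<forall>v\<in>carrier_vec nc. (A *\<^sub>v v) \<bullet> (A *\<^sub>v v) \<le> c * (v \<bullet> v)"
proof -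
  have "\<forall>i. \<exists>c. 0 \<le> c \<and> (\<forall>v. (\<Sum>k<nc. A $$ (i, k) * v k)\<^sup>2 \<le> c * (\<Sum>k<nc. (v k)\<^sup>2))"
    using linear_form_bounded[of "{..<nc}"] by simp
  from choice[OF this] obtain c where "\<forall>i. 0 \<le> c i \<and>
    (\<forall>v. (\<Sum>k<nc. A $$ (i, k) * v k)\<^sup>2 \<le> c i * (\<Sum>k<nc. (v k)\<^sup>2))" ..
  then have c: "\<And>i. 0 \<le> c i"
    "\<And>i v. (\<Sum>k<nc. A $$ (i, k) * v k)\<^sup>2 \<le> c i * (\<Sum>k<nc. (v k)\<^sup>2)" by blast+
  have "(A *\<^sub>v v) \<bullet> (A *\<^sub>v v) \<le> (\<Sum>i<nr. c i) * (v \<bullet> v)" if v: "v \<in> carrier_vec nc" for v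
  proof -
    have "(A *\<^sub>v v) \<bullet> (A *\<^sub>v v) = (\<Sum>i<nr. (\<Sum>k<nc. A $$ (i, k) * v $ k)\<^sup>2)"
      using A v by (subst self_scalar_prod[of _ nr])
        (auto simp: scalar_prod_def atLeast0LessThan intro!: sum.cong)
    also have "\<dots> \<le> (\<Sum>i<nr. c i * (v \<bullet> v))"
      using c(2) by (intro sum_mono) (simp add: self_scalar_prod[OF v])
    finally show ?thesis by (simp add: sum_distrib_right)
  qed
  then show ?thesis using c(1) by (intro exI[of _ "\<Sum>i<nr. c i"]) (auto simp: sum_nonneg)
qed

text \<open>The left inverse bounds the norm of \<open>v\<close> by that of the stacked product,
  whose squared norm is the sum over the blocks \<open>F i\<close>. Since \<open>u i\<close> lies in
  the kernel, \<open>F i\<close> has the same value at \<open>v\<close> as at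
  \<open>v - u i\<close>, and boundedness of \<open>F i\<close> finishes the estimate.\<close>

lemma stacked_kernels_coercive:
  fixes F :: "'a \<Rightarrow> real mat"
  assumes F: "\<And>i. i \<in> set xs \<Longrightarrow> F i \<in> carrier_mat (r i) d"
    and B: "B \<in> carrier_mat d (\<Sum>i\<leftarrow>xs. r i)" "B * stack_mats d (map F xs) = 1\<^sub>m d"
  shows "\<exists>C\<ge>0. \<forall>v\<in>carrier_vec d. \<forall>u. (\<forall>i\<in>set xs. u i \<in> mat_kernel (F i)) \<longrightarrow>
    v \<bullet> v \<le> C * (\<Sum>i\<leftarrow>xs. (v - u i) \<bullet> (v - u i))"
proof -
  obtain b where b: "0 \<le> b" "\<And>v. v \<in> carrier_vec (\<Sum>i\<leftarrow>xs. r i) \<Longrightarrow> (B *\<^sub>v v) \<bullet> (B *\<^sub>v v) \<le> b * (v \<bullet> v)"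
    using mult_mat_vec_bounded[OF B(1)] by blast
  have "\<forall>i. \<exists>c. 0 \<le> c \<and>
      (i \<in> set xs \<longrightarrow> (\<forall>v\<in>carrier_vec d. (F i *\<^sub>v v) \<bullet> (F i *\<^sub>v v) \<le> c * (v \<bullet> v)))"
  proof
    fix i
    show "\<exists>c. 0 \<le> c \<and>
      (i \<in> set xs \<longrightarrow> (\<forall>v\<in>carrier_vec d. (F i *\<^sub>v v) \<bullet> (F i *\<^sub>v v) \<le> c * (v \<bullet> v)))"
      using mult_mat_vec_bounded[OF F[of i]] by (cases "i \<in> set xs") auto
  qed
  from choice[OF this] obtain c where "\<forall>i. 0 \<le> c i \<and>
      (i \<in> set xs \<longrightarrow> (\<forall>v\<in>carrier_vec d. (F i *\<^sub>v v) \<bullet> (F i *\<^sub>v v) \<le> c i * (v \<bullet> v)))" ..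
  then have c: "\<And>i. 0 \<le> c i"
    "\<And>i v. i \<in> set xs \<Longrightarrow> v \<in> carrier_vec d \<Longrightarrow> (F i *\<^sub>v v) \<bullet> (F i *\<^sub>v v) \<le> c i * (v \<bullet> v)"
    by blast+
  define c' where "c' = (\<Sum>i\<leftarrow>xs. c i)"
  have c': "0 \<le> c'" "\<And>i. i \<in> set xs \<Longrightarrow> c i \<le> c'"
    unfolding c'_def using c(1) by (auto intro!: sum_list_nonneg member_le_sum_list)
  have "v \<bullet> v \<le> b * c' * (\<Sum>i\<leftarrow>xs. (v - u i) \<bullet> (v - u i))"
    if v: "v \<in> carrier_vec d" and u: "\<forall>i\<in>set xs. u i \<in> mat_kernel (F i)" for v u
  proof -
    let ?M = "stack_mats d (map F xs)"
    have M: "?M \<in> carrier_mat (\<Sum>i\<leftarrow>xs. r i) d" using F by (rule stack_mats_carrier)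
    have Fv: "F i *\<^sub>v v \<in> carrier_vec (r i)" if "i \<in> set xs" for i
      using F[OF that] v by simp
    have "v = B *\<^sub>v (?M *\<^sub>v v)" using B M v by (simp flip: assoc_mult_mat_vec)
    then have "v \<bullet> v \<le> b * ((?M *\<^sub>v v) \<bullet> (?M *\<^sub>v v))"
      using b(2)[of "?M *\<^sub>v v"] M v by auto
    also have "(?M *\<^sub>v v) \<bullet> (?M *\<^sub>v v) = (\<Sum>i\<leftarrow>xs. (F i *\<^sub>v v) \<bullet> (F i *\<^sub>v v))"
      using stack_mats_mult_vec[of xs F r d v, OF F v] Fv stack_vecs_scalar_prod[of xs "\<lambda>i. F i *\<^sub>v v" r "\<lambda>i. F i *\<^sub>v v"]
      by simp
    also have "b * \<dots> \<le> b * (\<Sum>i\<leftarrow>xs. c' * ((v - u i) \<bullet> (v - u i)))"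
    proof (intro mult_left_mono[OF _ b(1)] sum_list_mono)
      fix i assume i: "i \<in> set xs"
      then have ui: "u i \<in> carrier_vec d" "F i *\<^sub>v u i = 0\<^sub>v (r i)"
        using u mat_kernelD[OF F[OF i], of "u i"] by auto
      have "F i *\<^sub>v (v - u i) = F i *\<^sub>v v"
        using F[OF i] v ui by (simp add: mult_minus_distrib_mat_vec[of _ "r i" d])
      then have "(F i *\<^sub>v v) \<bullet> (F i *\<^sub>v v) \<le> c i * ((v - u i) \<bullet> (v - u i))"
        using c(2)[OF i, of "v - u i"] v ui by auto
      also have "\<dots> \<le> c' * ((v - u i) \<bullet> (v - u i))"
        using c'(2)[OF i] by (intro mult_right_mono self_scalar_prod_nonneg)
      finally show "(F i *\<^sub>v v) \<bullet> (F i *\<^sub>v v) \<le> c' * ((v - u i) \<bullet> (v - u i))" .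
    qed
    finally show ?thesis by (simp add: sum_list_const_mult mult.assoc)
  qed
  then show ?thesis using b(1) c'(1) by (intro exI[of _ "b * c'"]) auto
qed

text \<open>For \<open>u\<close> in the kernel, \<open>u'\<close> is the orthogonal projection of
  \<open>w\<close> onto the kernel, although \<open>P\<close> is applied to \<open>u - w\<close>:
  the difference \<open>w - u'\<close> is minus the residual of projecting \<open>u - w\<close>,
  hence orthogonal to the kernel and to \<open>u'\<close>.\<close>

lemma projection_step:
  fixes K :: "real mat"
  assumes P: "orth_projection_mat d (mat_kernel K) P" and K: "K \<in> carrier_mat r d"
    and u: "u \<in> mat_kernel K" and w: "w \<in> carrier_vec d"
  defines "u' \<equiv> u - P *\<^sub>v (u - w)"
  shows "u' \<in> mat_kernel K" "w \<bullet> w = u' \<bullet> u' + (w - u') \<bullet> (w - u')"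
proof -
  have uc: "u \<in> carrier_vec d" "K *\<^sub>v u = 0\<^sub>v r" using mat_kernelD[OF K u] by auto
  have uw: "u - w \<in> carrier_vec d" using uc w by simp
  have p: "P *\<^sub>v (u - w) \<in> mat_kernel K"
    and orth: "\<And>x. x \<in> mat_kernel K \<Longrightarrow> (u - w - P *\<^sub>v (u - w)) \<bullet> x = 0"
    using P uw by (auto simp: orth_projection_mat_def)
  define p where "p = P *\<^sub>v (u - w)"
  have pc: "p \<in> carrier_vec d" "K *\<^sub>v p = 0\<^sub>v r" using mat_kernelD[OF K p] by (auto simp: p_def)
  have u': "u' = u - p" "u' \<in> carrier_vec d" using uc pc by (auto simp: u'_def p_def)
  have "K *\<^sub>v u' = 0\<^sub>v r" unfolding u'(1)
    using K uc pc by (simp add: mult_minus_distrib_mat_vec[of _ r d])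
  then show ker: "u' \<in> mat_kernel K" by (rule mat_kernelI[OF K u'(2)])
  have wu: "w - u' = - (u - w - p)" using uc pc w by (intro eq_vecI) (auto simp: u'(1))
  have "(w - u') \<bullet> u' = - ((u - w - p) \<bullet> u')"
    unfolding wu using uc w pc u'(2) by (subst scalar_prod_uminus_left) auto
  then have "(w - u') \<bullet> u' = 0" using orth[OF ker] by (simp add: p_def)
  moreover have "(w - u') + u' = w" using w u'(2) by (intro eq_vecI) auto
  moreover have "((w - u') + u') \<bullet> ((w - u') + u') =
      (w - u') \<bullet> (w - u') + 2 * ((w - u') \<bullet> u') + u' \<bullet> u'"
    using w u'(2) comm_scalar_prod[of u' d "w - u'"]
      add_scalar_prod_distrib[of "w - u'" d u' "(w - u') + u'"]
      scalar_prod_add_distrib[of "w - u'" d "w - u'" u']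
      scalar_prod_add_distrib[of u' d "w - u'" u'] by simp
  ultimately show "w \<bullet> w = u' \<bullet> u' + (w - u') \<bullet> (w - u')" by simp
qed

section \<open>Incidence matrices\<close>

lemma incidence_matrix_col_sum:
  assumes "head D k < m" "tail D k < m" "head D k \<noteq> tail D k" "k < p"
  shows "(\<Sum>i<m. incidence_matrix m p D $$ (i, k)) = 0"
proof -
  have "(\<Sum>i<m. incidence_matrix m p D $$ (i, k))
      = (\<Sum>i<m. (if i = head D k then 1 else 0) - (if i = tail D k then 1 else 0))"
    using assms by (intro sum.cong) (auto simp: incidence_matrix_def)
  also have "\<dots> = 0" using assms by (simp add: sum_subtractf)
  finally show ?thesis .
qed

text \<open>The witness \<open>y\<close> is the signed arc sequence of a walk from \<open>0\<close> to \<open>i\<close>.\<close>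

lemma incidence_matrix_walk:
  fixes D :: "(nat, nat) pre_digraph"
  assumes "(0, i) \<in> rtrancl_on {..<m} E"
    and E: "\<And>u v. (u, v) \<in> E \<Longrightarrow> \<exists>k<p. (u = tail D k \<and> v = head D k) \<or> (u = head D k \<and> v = tail D k)"
    and loopfree: "\<And>k. k < p \<Longrightarrow> head D k \<noteq> tail D k"
  shows "\<exists>y. \<forall>j<m. (\<Sum>k<p. incidence_matrix m p D $$ (j, k) * y k)
    = (if j = i then 1 else 0) - (if j = 0 then 1 else 0)"
  using assms(1)
proof (induct rule: rtrancl_on_induct)
  case base
  show ?case by (intro exI[of _ "\<lambda>_. 0"]) auto
next
  case (step u v)
  let ?H = "incidence_matrix m p D"
  obtain y where y: "\<And>j. j < m \<Longrightarrow> (\<Sum>k<p. ?H $$ (j, k) * y k) = (if j = u then 1 else 0) - (if j = 0 then 1 else 0)"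
    using step by blast
  obtain k where k: "k < p" "(u = tail D k \<and> v = head D k) \<or> (u = head D k \<and> v = tail D k)"
    using E step by blast
  \<comment> \<open>Column \<open>k\<close> is the unit vector at the head minus that at the tail;
    the sign \<open>s\<close> is that of the traversal, so that \<open>s\<close> times the column is
    the unit vector at \<open>v\<close> minus that at \<open>u\<close>.\<close>
  define s :: real where "s = (if u = tail D k then 1 else -1)"
  have "(\<Sum>l<p. ?H $$ (j, l) * (y l + (if l = k then s else 0)))
      = (if j = v then 1 else 0) - (if j = 0 then 1 else 0)" if j: "j < m" for j
  proof -
    have "(\<Sum>l<p. ?H $$ (j, l) * (y l + (if l = k then s else 0)))
        = (\<Sum>l<p. ?H $$ (j, l) * y l + (if l = k then ?H $$ (j, l) * s else 0))"
      by (intro sum.cong) (auto simp: distrib_left)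
    also have "\<dots> = (\<Sum>l<p. ?H $$ (j, l) * y l) + (\<Sum>l<p. if l = k then ?H $$ (j, l) * s else 0)"
      by (rule sum.distrib)
    also have "(\<Sum>l<p. if l = k then ?H $$ (j, l) * s else 0) = ?H $$ (j, k) * s" using k by simp
    also have "?H $$ (j, k) * s = (if j = v then 1 else 0) - (if j = u then 1 else 0)"
    proof -
      have "?H $$ (j, k) = (if j = head D k then 1 else if j = tail D k then -1 else 0)"
        using k(1) j by (simp add: incidence_matrix_def)
      then show ?thesis using k(2) loopfree[OF k(1)] unfolding s_def by (elim disjE) auto
    qed
    finally show ?thesis using y[OF j] by simp
  qed
  then show ?case by (intro exI[of _ "\<lambda>l. y l + (if l = k then s else 0)"]) simp
qed

text \<open>Deleting row \<open>0\<close> of \<open>H\<close> leaves a square matrix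
  \<open>R\<close>. The walk vectors for the vertices other than \<open>0\<close> are the columns of
  a right inverse \<open>Y\<close>: in the remaining rows the entry for the start \<open>0\<close>
  disappears. A right inverse of a square matrix is also a left inverse, so \<open>R\<close> is
  injective.\<close>

lemma injective_of_walk_vectors:
  assumes walks: "\<And>i. i < m \<Longrightarrow> \<exists>y. \<forall>j<m. (\<Sum>k<m - 1. H $$ (j, k) * y k)
      = (if j = i then 1 else 0) - (if j = (0::nat) then 1 else (0::real))"
    and w: "\<And>i. i < m \<Longrightarrow> (\<Sum>k<m - 1. H $$ (i, k) * w k) = 0" and "k < m - 1"
  shows "w k = 0"
proof -
  have "\<forall>i. \<exists>y. i < m \<longrightarrow> (\<forall>j<m. (\<Sum>k<m - 1. H $$ (j, k) * y k)
      = (if j = i then 1 else 0) - (if j = 0 then 1 else 0))"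
    using walks by simp
  from choice[OF this] obtain y where "\<forall>i<m. \<forall>j<m. (\<Sum>k<m - 1. H $$ (j, k) * y i k)
      = (if j = i then 1 else 0) - (if j = 0 then 1 else 0)" ..
  then have y: "(\<Sum>k<m - 1. H $$ (j, k) * y i k)
      = (if j = i then 1 else 0) - (if j = 0 then 1 else 0)" if "i < m" "j < m" for i j
    using that by blast
  define R where "R = mat (m - 1) (m - 1) (\<lambda>(j, k). H $$ (Suc j, k))"
  define Y where "Y = mat (m - 1) (m - 1) (\<lambda>(k, i). y (Suc i) k)"
  have RY: "R * Y = 1\<^sub>m (m - 1)"
    using y by (intro eq_matI) (auto simp: R_def Y_def scalar_prod_def atLeast0LessThan)
  have YR: "Y * R = 1\<^sub>m (m - 1)"
    by (rule mat_mult_left_right_inverse[OF _ _ RY]) (auto simp: R_def Y_def)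
  define v where "v = vec (m - 1) w"
  have "R *\<^sub>v v = 0\<^sub>v (m - 1)"
    using w by (intro eq_vecI) (auto simp: R_def v_def scalar_prod_def atLeast0LessThan)
  moreover have "v = Y *\<^sub>v (R *\<^sub>v v)"
    using YR by (subst assoc_mult_mat_vec[symmetric, of _ "m - 1" "m - 1" _ "m - 1"]) (auto simp: R_def Y_def v_def)
  ultimately have "v = 0\<^sub>v (m - 1)"
    by (intro eq_vecI) (auto simp: Y_def)
  then have "v $ k = 0" using \<open>k < m - 1\<close> by simp
  then show ?thesis using \<open>k < m - 1\<close> by (simp add: v_def)
qed

section \<open>The coupled system\<close>

lemma self_scalar_prod_eq_sqn:
  assumes "v \<in> carrier_vec d" "\<And>k. k < d \<Longrightarrow> v $ k = f k"
  shows "v \<bullet> v = sqn {..<d} f"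
  using assms by (simp add: self_scalar_prod sqn_def)

lemma sum_list_upt: "(\<Sum>i\<leftarrow>[0..<m]. f i) = (\<Sum>i<m. f i)" for f :: "nat \<Rightarrow> 'a :: comm_monoid_add"
  by (simp add: interv_sum_list_conv_sum_set_nat atLeast0LessThan)

text \<open>The graph is abstracted into two properties of \<open>H\<close>: its columns sum to zero
  and it is injective.\<close>

locale coupled_least_squares =
  fixes m n :: nat and ni :: "nat \<Rightarrow> nat" and Ai :: "nat \<Rightarrow> real mat" and bi :: "nat \<Rightarrow> real vec"
    and H :: "real mat" and Mi :: "nat \<Rightarrow> real mat"
  assumes m_pos: "0 < m"
    and Ai: "\<And>i. i < m \<Longrightarrow> Ai i \<in> carrier_mat (ni i) n"
    and full_rank: "\<And>i. i < m \<Longrightarrow> full_column_rank (Ai i)"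
    and bi: "\<And>i. i < m \<Longrightarrow> bi i \<in> carrier_vec (ni i)"
    and H: "H \<in> carrier_mat m (m - 1)"
    and H_col_sum: "\<And>k. k < m - 1 \<Longrightarrow> (\<Sum>i<m. H $$ (i, k)) = 0"
    and H_injective: "\<And>w k. (\<And>i. i < m \<Longrightarrow> (\<Sum>k<m - 1. H $$ (i, k) * w k) = 0) \<Longrightarrow> k < m - 1 \<Longrightarrow>
      w k = 0"
    and Mi: "\<And>i. i < m \<Longrightarrow> Mi i = ((Ai i)\<^sup>T * Ai i) @\<^sub>c (mat_of_row (row H i) \<otimes>\<^sub>k 1\<^sub>m n)"
begin

section \<open>The normal equation of the stacked system\<close>

definition A :: "real mat" where "A = stack_mats n (map Ai [0..<m])"
definition b :: "real vec" where "b = stack_vecs (map bi [0..<m])"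
definition M :: "real mat" where "M = stack_mats (m * n) (map Mi [0..<m])"
definition q :: "real vec" where "q = stack_vecs (map (\<lambda>i. (Ai i)\<^sup>T *\<^sub>v bi i) [0..<m])"

lemma A_carrier: "A \<in> carrier_mat (\<Sum>i\<leftarrow>[0..<m]. ni i) n"
  unfolding A_def using Ai by (intro stack_mats_carrier) auto

lemma b_carrier: "b \<in> carrier_vec (\<Sum>i\<leftarrow>[0..<m]. ni i)"
  unfolding b_def using bi by (intro stack_vecs_carrier) auto

lemma A_mult_vec: "x \<in> carrier_vec n \<Longrightarrow> A *\<^sub>v x = stack_vecs (map (\<lambda>i. Ai i *\<^sub>v x) [0..<m])"
  unfolding A_def using Ai by (intro stack_mats_mult_vec[of _ _ ni]) auto

lemma normal_lhs:
  assumes x: "x \<in> carrier_vec n" and c: "c < n"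
  shows "(A\<^sup>T *\<^sub>v (A *\<^sub>v x)) $ c = (\<Sum>i<m. ((Ai i)\<^sup>T *\<^sub>v (Ai i *\<^sub>v x)) $ c)"
proof -
  have "Ai i *\<^sub>v x \<in> carrier_vec (ni i)" if "i \<in> set [0..<m]" for i
    using Ai[of i] that x by (intro mult_mat_vec_carrier) auto
  then show ?thesis
    unfolding A_mult_vec[OF x] unfolding A_def sum_list_upt[symmetric] using Ai c
    by (intro stack_mats_transpose_mult_vec[of _ _ ni]) auto
qed

lemma normal_rhs: "c < n \<Longrightarrow> (A\<^sup>T *\<^sub>v b) $ c = (\<Sum>i<m. ((Ai i)\<^sup>T *\<^sub>v bi i) $ c)"
  unfolding A_def b_def sum_list_upt[symmetric] using Ai bi
  by (intro stack_mats_transpose_mult_vec[of _ _ ni]) auto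

text \<open>Pairing the hypothesis with \<open>x\<close> gives the squared norm of the stacked
  product, a sum of squared norms over the blocks. So block \<open>0\<close> sends \<open>x\<close>
  to zero, and it has full column rank.\<close>

lemma gram_injective:
  assumes x: "x \<in> carrier_vec n" and "A\<^sup>T *\<^sub>v (A *\<^sub>v x) = 0\<^sub>v n"
  shows "x = 0\<^sub>v n"
proof -
  have c: "Ai i *\<^sub>v x \<in> carrier_vec (ni i)" if "i \<in> set [0..<m]" for i
    using Ai[of i] that x by (intro mult_mat_vec_carrier) auto
  have Ax: "A *\<^sub>v x \<in> carrier_vec (\<Sum>i\<leftarrow>[0..<m]. ni i)" using A_carrier x by (rule mult_mat_vec_carrier)
  have "(A *\<^sub>v x) \<bullet> (A *\<^sub>v x) = (A\<^sup>T *\<^sub>v (A *\<^sub>v x)) \<bullet> x"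
    by (rule transpose_vec_mult_scalar[OF A_carrier x Ax, symmetric])
  also have "\<dots> = 0" using assms by simp
  finally have "(\<Sum>i<m. (Ai i *\<^sub>v x) \<bullet> (Ai i *\<^sub>v x)) = 0"
    unfolding A_mult_vec[OF x]
    using stack_vecs_scalar_prod[of "[0..<m]" "\<lambda>i. Ai i *\<^sub>v x" ni "\<lambda>i. Ai i *\<^sub>v x", OF c c]
    by (simp add: sum_list_upt)
  then have "(Ai 0 *\<^sub>v x) \<bullet> (Ai 0 *\<^sub>v x) = 0"
    using m_pos by (simp add: sum_nonneg_eq_0_iff self_scalar_prod_nonneg)
  then have "Ai 0 *\<^sub>v x = 0\<^sub>v (ni 0)" using c[of 0] m_pos by (simp add: self_scalar_prod_eq_0_iff)
  then show ?thesis using full_column_rank_kernel[OF Ai full_rank x] m_pos by blast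
qed

lemma least_squares_unique_solution: "\<exists>!x. least_squares_solution A b x"
proof -
  have G: "A\<^sup>T * A \<in> carrier_mat n n" using A_carrier by auto
  have assoc: "(A\<^sup>T * A) *\<^sub>v x = A\<^sup>T *\<^sub>v (A *\<^sub>v x)" if "x \<in> carrier_vec n" for x
    using A_carrier that by (intro assoc_mult_mat_vec) auto
  obtain B where B: "B \<in> carrier_mat n n" "B * (A\<^sup>T * A) = 1\<^sub>m n" "(A\<^sup>T * A) * B = 1\<^sub>m n"
  proof (rule square_inverse_of_trivial_kernel[OF G])
    show "x = 0\<^sub>v n" if "x \<in> carrier_vec n" "(A\<^sup>T * A) *\<^sub>v x = 0\<^sub>v n" for x
      using that assoc[OF that(1)] gram_injective by simp
  qed blast
  have c: "A\<^sup>T *\<^sub>v b \<in> carrier_vec n" using A_carrier by (intro mult_mat_vec_carrier[OF _ b_carrier]) simp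
  show ?thesis
  proof (rule ex1I[of _ "B *\<^sub>v (A\<^sup>T *\<^sub>v b)"])
    have x: "B *\<^sub>v (A\<^sup>T *\<^sub>v b) \<in> carrier_vec n" by (rule mult_mat_vec_carrier[OF B(1) c])
    have "(A\<^sup>T * A) *\<^sub>v (B *\<^sub>v (A\<^sup>T *\<^sub>v b)) = A\<^sup>T *\<^sub>v b"
      using assoc_mult_mat_vec[OF G B(1) c] B(3) c by simp
    then show "least_squares_solution A b (B *\<^sub>v (A\<^sup>T *\<^sub>v b))"
      using x A_carrier unfolding least_squares_solution_def assoc[OF x] by simp
  next
    fix y assume "least_squares_solution A b y"
    then have y: "y \<in> carrier_vec n" "A\<^sup>T *\<^sub>v b = (A\<^sup>T * A) *\<^sub>v y"
      using A_carrier assoc by (auto simp: least_squares_solution_def)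
    show "y = B *\<^sub>v (A\<^sup>T *\<^sub>v b)"
      unfolding y(2) using assoc_mult_mat_vec[OF B(1) G y(1)] B(2) y(1) by simp
  qed
qed

section \<open>The square block system\<close>

lemma block_dim: "n + (m - 1) * n = m * n"
  using m_pos by (cases m) auto

lemma H_row: "i < m \<Longrightarrow> row H i \<in> carrier_vec (m - 1)"
  using H by (intro carrier_vecI) simp

lemma gram_block_carrier: "i < m \<Longrightarrow> (Ai i)\<^sup>T * Ai i \<in> carrier_mat n n"
  using Ai[of i] by (intro mult_carrier_mat[of _ _ "ni i"]) auto

lemma Mi_carrier: "i < m \<Longrightarrow> Mi i \<in> carrier_mat n (m * n)"
  using append_cols_carrier[OF gram_block_carrier kronecker_row_carrier[OF H_row], of i i]
  unfolding block_dim by (simp add: Mi)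

text \<open>After the first \<open>n\<close> entries, which form \<open>x\<close>, entry
  \<open>c\<close> of the sub-vector numbered \<open>k\<close> from 0 sits at index
  \<open>n + (k * n + c)\<close>.\<close>

lemma Mi_mult_vec:
  assumes i: "i < m" and z: "z \<in> carrier_vec (m * n)" and c: "c < n"
  shows "(Mi i *\<^sub>v z) $ c = ((Ai i)\<^sup>T *\<^sub>v (Ai i *\<^sub>v vec_first z n)) $ c +
    (\<Sum>k<m - 1. H $$ (i, k) * z $ (n + (k * n + c)))"
proof -
  let ?K = "mat_of_row (row H i) \<otimes>\<^sub>k 1\<^sub>m n" and ?y = "vec_last z ((m - 1) * n)"
  have K: "?K \<in> carrier_mat n ((m - 1) * n)" using H_row[OF i] by (rule kronecker_row_carrier)
  have z': "z \<in> carrier_vec (n + (m - 1) * n)" using z unfolding block_dim .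
  have "(Mi i *\<^sub>v z) $ c = (((Ai i)\<^sup>T * Ai i) *\<^sub>v vec_first z n) $ c + (?K *\<^sub>v ?y) $ c"
    unfolding Mi[OF i] append_cols_mult_vec[OF gram_block_carrier[OF i] K z']
    using K c by (subst index_add_vec) auto
  also have "((Ai i)\<^sup>T * Ai i) *\<^sub>v vec_first z n = (Ai i)\<^sup>T *\<^sub>v (Ai i *\<^sub>v vec_first z n)"
    using Ai[OF i] by (intro assoc_mult_mat_vec[of _ n "ni i"]) auto
  also have "(?K *\<^sub>v ?y) $ c = (\<Sum>k<m - 1. row H i $ k * ?y $ (k * n + c))"
    using H_row[OF i] c by (intro kronecker_row_mult_vec) auto
  also have "\<dots> = (\<Sum>k<m - 1. H $$ (i, k) * z $ (n + (k * n + c)))"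
  proof (rule sum.cong[OF refl])
    fix k assume "k \<in> {..<m - 1}"
    then have k: "k < m - 1" by simp
    have "k * n + c < Suc k * n" using c by simp
    also have "\<dots> \<le> (m - 1) * n" using k by (intro mult_le_mono1) simp
    finally have "k * n + c < (m - 1) * n" .
    then have "?y $ (k * n + c) = z $ (n + (k * n + c))"
      using z' by (simp add: vec_last_def)
    then show "row H i $ k * ?y $ (k * n + c) = H $$ (i, k) * z $ (n + (k * n + c))"
      using H i k by simp
  qed
  finally show ?thesis .
qed

text \<open>Adding the block rows multiplies each later sub-vector by a column sum of
  \<open>H\<close>, which is zero; only the part with \<open>x\<close> survives.\<close>

lemma sum_Mi_mult_vec:
  assumes z: "z \<in> carrier_vec (m * n)" and c: "c < n"
  shows "(\<Sum>i<m. (Mi i *\<^sub>v z) $ c) = (A\<^sup>T *\<^sub>v (A *\<^sub>v vec_first z n)) $ c"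
proof -
  have "(\<Sum>i<m. \<Sum>k<m - 1. H $$ (i, k) * z $ (n + (k * n + c)))
      = (\<Sum>k<m - 1. (\<Sum>i<m. H $$ (i, k)) * z $ (n + (k * n + c)))"
    by (subst sum.swap) (simp add: sum_distrib_right)
  also have "\<dots> = 0" using H_col_sum by (intro sum.neutral) simp
  finally have H0: "(\<Sum>i<m. \<Sum>k<m - 1. H $$ (i, k) * z $ (n + (k * n + c))) = 0" .
  have "(\<Sum>i<m. (Mi i *\<^sub>v z) $ c)
      = (\<Sum>i<m. ((Ai i)\<^sup>T *\<^sub>v (Ai i *\<^sub>v vec_first z n)) $ c
          + (\<Sum>k<m - 1. H $$ (i, k) * z $ (n + (k * n + c))))"
    by (intro sum.cong refl Mi_mult_vec z c) simp
  also have "\<dots> = (\<Sum>i<m. ((Ai i)\<^sup>T *\<^sub>v (Ai i *\<^sub>v vec_first z n)) $ c)"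
    unfolding sum.distrib H0 by (rule add_0_right)
  also have "\<dots> = (A\<^sup>T *\<^sub>v (A *\<^sub>v vec_first z n)) $ c"
    by (rule normal_lhs[OF vec_first_carrier c, symmetric])
  finally show ?thesis .
qed

text \<open>Adding the block rows gives the homogeneous normal equation, so the \<open>x\<close>
  part vanishes. Then, for each fixed \<open>c\<close>, the entries \<open>c\<close> of the later
  sub-vectors form a vector annihilated by \<open>H\<close>.\<close>

lemma Mi_kernels_trivial:
  assumes z: "z \<in> carrier_vec (m * n)" and ker: "\<And>i. i < m \<Longrightarrow> Mi i *\<^sub>v z = 0\<^sub>v n"
  shows "z = 0\<^sub>v (m * n)"
proof -
  have "A\<^sup>T *\<^sub>v (A *\<^sub>v vec_first z n) = 0\<^sub>v n"
  proof (rule eq_vecI)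
    fix c assume "c < dim_vec (0\<^sub>v n :: real vec)"
    then have c: "c < n" by simp
    show "(A\<^sup>T *\<^sub>v (A *\<^sub>v vec_first z n)) $ c = 0\<^sub>v n $ c"
    proof -
      have "(\<Sum>i<m. (Mi i *\<^sub>v z) $ c) = 0"
        using c by (intro sum.neutral) (simp add: ker del: index_mult_mat_vec)
      then show ?thesis using c unfolding sum_Mi_mult_vec[OF z c] by (simp del: index_mult_mat_vec)
    qed
  qed (use A_carrier in simp)
  then have x: "vec_first z n = 0\<^sub>v n" by (rule gram_injective[OF vec_first_carrier])
  have y: "z $ (n + (k * n + c)) = 0" if c: "c < n" and k: "k < m - 1" for k c
  proof (rule H_injective[of "\<lambda>k. z $ (n + (k * n + c))", OF _ k])
    fix i assume i: "i < m"
    have "Ai i *\<^sub>v 0\<^sub>v n = 0\<^sub>v (ni i)"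
      using Ai[OF i] by (intro eq_vecI) simp_all
    moreover have "(Ai i)\<^sup>T *\<^sub>v 0\<^sub>v (ni i) = 0\<^sub>v n"
      using Ai[OF i] by (intro eq_vecI) simp_all
    ultimately have "((Ai i)\<^sup>T *\<^sub>v (Ai i *\<^sub>v vec_first z n)) $ c = 0"
      using c by (simp add: x del: index_mult_mat_vec)
    then show "(\<Sum>k<m - 1. H $$ (i, k) * z $ (n + (k * n + c))) = 0"
      using Mi_mult_vec[OF i z c] unfolding ker[OF i] index_zero_vec(1)[OF c] by linarith
  qed
  show ?thesis
  proof (rule eq_vecI)
    fix j assume "j < dim_vec (0\<^sub>v (m * n) :: real vec)"
    then have j: "j < m * n" by simp
    show "z $ j = 0\<^sub>v (m * n) $ j"
    proof (cases "j < n")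
      case True
      then have "z $ j = vec_first z n $ j" by (simp add: vec_first_def)
      then show ?thesis using True j by (simp add: x)
    next
      case False
      \<comment> \<open>\<open>l div n\<close> is the number of the sub-vector and
        \<open>l mod n\<close> the position inside it.\<close>
      define l where "l = j - n"
      have l: "j = n + l" using False by (simp add: l_def)
      have l2: "l < (m - 1) * n" using j block_dim l by linarith
      have "0 < n" using l2 by (rule contrapos_pp) simp
      then have "l mod n < n" by (rule mod_less_divisor)
      from y[OF this less_mult_imp_div_less[OF l2]] have "z $ j = 0"
        unfolding l div_mult_mod_eq .
      then show ?thesis using j by simp
    qed
  qed (use z in simp)
qed

lemma M_carrier: "M \<in> carrier_mat (m * n) (m * n)"
proof -
  have "M \<in> carrier_mat (\<Sum>i\<leftarrow>[0..<m]. n) (m * n)"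
    unfolding M_def using Mi_carrier by (intro stack_mats_carrier) auto
  then show ?thesis by (simp add: sum_list_upt)
qed

lemma M_mult_vec: "z \<in> carrier_vec (m * n) \<Longrightarrow> M *\<^sub>v z = stack_vecs (map (\<lambda>i. Mi i *\<^sub>v z) [0..<m])"
  unfolding M_def using Mi_carrier by (intro stack_mats_mult_vec[of _ _ "\<lambda>_. n"]) auto

lemma Ai_transpose_bi: "i < m \<Longrightarrow> (Ai i)\<^sup>T *\<^sub>v bi i \<in> carrier_vec n"
  using Ai[of i] bi[of i] by (intro mult_mat_vec_carrier) auto

lemma q_carrier: "q \<in> carrier_vec (m * n)"
proof -
  have "q \<in> carrier_vec (\<Sum>i\<leftarrow>[0..<m]. n)"
    unfolding q_def using Ai_transpose_bi by (intro stack_vecs_carrier) auto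
  then show ?thesis by (simp add: sum_list_upt)
qed

lemma M_solution_iff:
  assumes z: "z \<in> carrier_vec (m * n)"
  shows "M *\<^sub>v z = q \<longleftrightarrow> (\<forall>i<m. Mi i *\<^sub>v z = (Ai i)\<^sup>T *\<^sub>v bi i)"
proof -
  have "Mi i *\<^sub>v z \<in> carrier_vec n" if "i < m" for i
    using Mi_carrier[OF that] z by (rule mult_mat_vec_carrier)
  then show ?thesis
    unfolding M_mult_vec[OF z] q_def using Ai_transpose_bi
    by (subst stack_vecs_eq_iff[of _ _ "\<lambda>_. n"]) auto
qed

lemma M_invertible:
  obtains B where "B \<in> carrier_mat (m * n) (m * n)" "B * M = 1\<^sub>m (m * n)" "M * B = 1\<^sub>m (m * n)"
proof (rule square_inverse_of_trivial_kernel[OF M_carrier])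
  fix z assume z: "z \<in> carrier_vec (m * n)" and "M *\<^sub>v z = 0\<^sub>v (m * n)"
  then have "(\<Sum>i<m. (Mi i *\<^sub>v z) \<bullet> (Mi i *\<^sub>v z)) = 0"
    using stack_vecs_scalar_prod[of "[0..<m]" "\<lambda>i. Mi i *\<^sub>v z" "\<lambda>_. n" "\<lambda>i. Mi i *\<^sub>v z"]
      Mi_carrier by (simp add: M_mult_vec[OF z] sum_list_upt mult_mat_vec_carrier[OF _ z])
  then have "\<forall>i<m. (Mi i *\<^sub>v z) \<bullet> (Mi i *\<^sub>v z) = 0"
    by (simp add: sum_nonneg_eq_0_iff self_scalar_prod_nonneg)
  then have "Mi i *\<^sub>v z = 0\<^sub>v n" if "i < m" for i
    using that self_scalar_prod_eq_0_iff[OF mult_mat_vec_carrier[OF Mi_carrier[OF that] z]] by simp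
  then show "z = 0\<^sub>v (m * n)" by (rule Mi_kernels_trivial[OF z])
qed (use that in blast)

lemma M_solvable: "\<exists>z\<in>carrier_vec (m * n). M *\<^sub>v z = q"
proof -
  obtain B where B: "B \<in> carrier_mat (m * n) (m * n)" "M * B = 1\<^sub>m (m * n)"
    using M_invertible by blast
  have "M *\<^sub>v (B *\<^sub>v q) = q"
    using assoc_mult_mat_vec[OF M_carrier B(1) q_carrier] B(2) q_carrier by simp
  then show ?thesis using mult_mat_vec_carrier[OF B(1) q_carrier] by blast
qed

lemma M_solution_normal_equation:
  assumes z: "z \<in> carrier_vec (m * n)" and "M *\<^sub>v z = q"
  shows "A\<^sup>T *\<^sub>v (A *\<^sub>v vec_first z n) = A\<^sup>T *\<^sub>v b"
proof (rule eq_vecI)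
  fix c assume "c < dim_vec (A\<^sup>T *\<^sub>v b)"
  then have c: "c < n" using A_carrier by simp
  show "(A\<^sup>T *\<^sub>v (A *\<^sub>v vec_first z n)) $ c = (A\<^sup>T *\<^sub>v b) $ c"
    using assms M_solution_iff[OF z] by (simp flip: sum_Mi_mult_vec[OF z c] add: normal_rhs[OF c])
qed simp

lemma error_coercive:
  "\<exists>C\<ge>0. \<forall>v\<in>carrier_vec (m * n). \<forall>u. (\<forall>i<m. u i \<in> mat_kernel (Mi i)) \<longrightarrow>
    v \<bullet> v \<le> C * (\<Sum>i<m. (v - u i) \<bullet> (v - u i))"
proof -
  obtain B where B: "B \<in> carrier_mat (m * n) (m * n)" "B * M = 1\<^sub>m (m * n)"
    using M_invertible by blast
  have "\<exists>C\<ge>0. \<forall>v\<in>carrier_vec (m * n). \<forall>u. (\<forall>i\<in>set [0..<m]. u i \<in> mat_kernel (Mi i)) \<longrightarrow>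
    v \<bullet> v \<le> C * (\<Sum>i\<leftarrow>[0..<m]. (v - u i) \<bullet> (v - u i))"
    using B Mi_carrier unfolding M_def
    by (intro stacked_kernels_coercive[of _ _ "\<lambda>_. n" _ B]) (auto simp: sum_list_upt)
  moreover have "(\<forall>i\<in>set [0..<m]. Q i) \<longleftrightarrow> (\<forall>i<m. Q i)" for Q by auto
  ultimately show ?thesis unfolding sum_list_upt by simp
qed

section \<open>Dynamics of the errors\<close>

text \<open>Subtracting \<open>s\<close> commutes with averaging and the factor
  \<open>card S\<close> cancels, so the update becomes \<open>u - P (u - w)\<close> with
  \<open>u\<close> the own error and \<open>w\<close> the mean error, as in
  \<open>projection_step\<close>.\<close>

lemma error_step:
  assumes P: "orth_projection_mat (m * n) (mat_kernel (Mi i)) P" and i: "i < m"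
    and S: "finite S" "S \<noteq> {}" and z: "\<And>j. j \<in> S \<Longrightarrow> z j \<in> carrier_vec (m * n)"
    and zi: "z i \<in> carrier_vec (m * n)" and s: "s \<in> carrier_vec (m * n)"
    and ker: "z i - s \<in> mat_kernel (Mi i)"
    and z': "z' = z i - (1 / real (card S)) \<cdot>\<^sub>v
      (P *\<^sub>v (real (card S) \<cdot>\<^sub>v z i - finsum_vec TYPE(real) (m * n) z S))"
  defines "w \<equiv> vec (m * n) (\<lambda>k. (\<Sum>j\<in>S. (z j - s) $ k) / card S)"
  shows "z' - s \<in> mat_kernel (Mi i)"
    and "w \<bullet> w = (z' - s) \<bullet> (z' - s) + (w - (z' - s)) \<bullet> (w - (z' - s))"
proof -
  define c where "c = real (card S)"
  have c: "c \<noteq> 0" using S by (simp add: c_def)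
  define u where "u = z i - s"
  have u: "u \<in> carrier_vec (m * n)" using zi s by (simp add: u_def)
  have w: "w \<in> carrier_vec (m * n)" by (simp add: w_def)
  have Pc: "P \<in> carrier_mat (m * n) (m * n)" using P by (simp add: orth_projection_mat_def)
  have fs: "finsum_vec TYPE(real) (m * n) z S \<in> carrier_vec (m * n)"
    using z by (intro finsum_vec_closed) auto
  \<comment> \<open>The vector \<open>s\<close> occurs \<open>card S\<close> times in both terms and
    cancels.\<close>
  have "c \<cdot>\<^sub>v z i - finsum_vec TYPE(real) (m * n) z S = c \<cdot>\<^sub>v (u - w)"
  proof (rule eq_vecI)
    fix k assume "k < dim_vec (c \<cdot>\<^sub>v (u - w))"
    then have k: "k < m * n" by (simp add: w_def)
    have "(\<Sum>j\<in>S. (z j - s) $ k) = (\<Sum>j\<in>S. z j $ k - s $ k)"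
      using s k by (intro sum.cong) auto
    also have "\<dots> = (\<Sum>j\<in>S. z j $ k) - c * s $ k" by (simp add: sum_subtractf c_def)
    finally have "w $ k = (\<Sum>j\<in>S. z j $ k) / c - s $ k"
      using k c by (simp add: w_def c_def[symmetric] diff_divide_distrib)
    then show "(c \<cdot>\<^sub>v z i - finsum_vec TYPE(real) (m * n) z S) $ k = (c \<cdot>\<^sub>v (u - w)) $ k"
      using k zi s w fs u c index_finsum_vec[OF S(1) k, of z] z
      by (simp add: u_def Pi_def right_diff_distrib)
  qed (use fs w in auto)
  then have "(1 / c) \<cdot>\<^sub>v (P *\<^sub>v (c \<cdot>\<^sub>v z i - finsum_vec TYPE(real) (m * n) z S)) = P *\<^sub>v (u - w)"
    using mult_mat_vec[OF Pc, of "u - w" c] u w c by (simp add: smult_smult_assoc)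
  then have z'u: "z' - s = u - P *\<^sub>v (u - w)"
    unfolding z' c_def[symmetric] u_def using zi s Pc by (intro eq_vecI) auto
  show "z' - s \<in> mat_kernel (Mi i)"
    and "w \<bullet> w = (z' - s) \<bullet> (z' - s) + (w - (z' - s)) \<bullet> (w - (z' - s))"
    unfolding z'u using projection_step[OF P Mi_carrier[OF i] _ w, of u] ker by (auto simp: u_def)
qed

text \<open>The coordinates of the errors \<open>z t i - s\<close> form an instance of
  \<open>projected_averaging\<close>, with \<open>pythagoras\<close> from \<open>error_step\<close>
  and \<open>coercive\<close> from \<open>error_coercive\<close>.\<close>

theorem error_decay:
  assumes P: "\<And>i. i < m \<Longrightarrow> orth_projection_mat (m * n) (mat_kernel (Mi i)) (P i)"
    and N: "\<And>t i. 1 \<le> t \<Longrightarrow> i < m \<Longrightarrow> N t i \<subseteq> {..<m} \<and> i \<in> N t i"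
    and rep: "repeatedly_jointly_strongly_connected (\<lambda>t. neighbor_graph m (N t))"
    and z: "\<And>t i. 1 \<le> t \<Longrightarrow> i < m \<Longrightarrow> z t i \<in> carrier_vec (m * n)"
    and init: "\<And>i. i < m \<Longrightarrow> Mi i *\<^sub>v z 1 i = (Ai i)\<^sup>T *\<^sub>v bi i"
    and step: "\<And>t i. 1 \<le> t \<Longrightarrow> i < m \<Longrightarrow> z (Suc t) i = z t i - (1 / real (card (N t i))) \<cdot>\<^sub>v
      (P i *\<^sub>v (real (card (N t i)) \<cdot>\<^sub>v z t i - finsum_vec TYPE(real) (m * n) (z t) (N t i)))"
    and s: "s \<in> carrier_vec (m * n)" "M *\<^sub>v s = q"
  shows "\<exists>c r. 0 \<le> c \<and> 0 < r \<and> r < 1 \<and>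
    (\<forall>t\<ge>1. \<forall>i<m. (z t i - s) \<bullet> (z t i - s) \<le> c * r ^ t)"
proof -
  have finN: "finite (N t i)" "N t i \<noteq> {}" if "1 \<le> t" "i < m" for t i
    using N[OF that] finite_subset by auto
  have NI: "j < m" if "1 \<le> t" "i < m" "j \<in> N t i" for t i j using N[OF that(1,2)] that(3) by auto
  \<comment> \<open>At time 1 both \<open>z 1 i\<close> and \<open>s\<close> solve the block
    equation of agent \<open>i\<close>, so their difference lies in its kernel;
    \<open>error_step\<close> preserves this.\<close>
  have ker: "z t i - s \<in> mat_kernel (Mi i)" if "1 \<le> t" "i < m" for t i
    using that
  proof (induct t arbitrary: i rule: dec_induct)
    case base
    have "Mi i *\<^sub>v (z 1 i - s) = 0\<^sub>v n"
      using init base s M_solution_iff[OF s(1)] Mi_carrier[OF base] z[of 1 i] Ai_transpose_bi[OF base]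
      by (simp add: mult_minus_distrib_mat_vec[of _ n "m * n"])
    then show ?case using z[of 1 i] s base by (intro mat_kernelI[OF Mi_carrier[OF base]]) auto
  next
    case (step t)
    then have t: "1 \<le> t" "i < m" by auto
    show ?case
      by (rule error_step(1)[OF P[OF t(2)] t(2) finN[OF t] z[OF t(1) NI[OF t]] z[OF t] s(1)
        step(3)[OF t(2)] assms(6)[OF t]])
  qed
  let ?e = "\<lambda>t i k. (z t i - s) $ k"
  obtain C where C: "0 \<le> C" "\<forall>v\<in>carrier_vec (m * n). \<forall>u. (\<forall>i<m. u i \<in> mat_kernel (Mi i)) \<longrightarrow>
    v \<bullet> v \<le> C * (\<Sum>i<m. (v - u i) \<bullet> (v - u i))"
    using error_coercive by blast
  interpret projected_averaging m N "{..<m * n}" ?e C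
  proof
    fix t i :: nat assume ti: "1 \<le> t" "i < m"
    let ?w = "vec (m * n) (\<lambda>k. (\<Sum>j\<in>N t i. (z t j - s) $ k) / card (N t i))"
    have zs: "z (Suc t) i - s \<in> carrier_vec (m * n)" using z[of "Suc t" i] ti s by simp
    have "?w \<bullet> ?w = (z (Suc t) i - s) \<bullet> (z (Suc t) i - s)
        + (?w - (z (Suc t) i - s)) \<bullet> (?w - (z (Suc t) i - s))"
      by (rule error_step(2)[OF P[OF ti(2)] ti(2) finN[OF ti] z[OF ti(1) NI[OF ti]] z[OF ti] s(1)
        ker[OF ti] step[OF ti]])
    moreover have "?w \<bullet> ?w = sqn {..<m * n} (\<lambda>k. (\<Sum>j\<in>N t i. ?e t j k) / card (N t i))"
      by (rule self_scalar_prod_eq_sqn) auto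
    moreover have "(z (Suc t) i - s) \<bullet> (z (Suc t) i - s) = sqn {..<m * n} (?e (Suc t) i)"
      by (rule self_scalar_prod_eq_sqn[OF zs refl])
    moreover have "(?w - (z (Suc t) i - s)) \<bullet> (?w - (z (Suc t) i - s)) = sqn {..<m * n}
        (\<lambda>k. (\<Sum>j\<in>N t i. ?e t j k) / card (N t i) - ?e (Suc t) i k)"
      by (rule self_scalar_prod_eq_sqn) (use zs s in auto)
    ultimately show "sqn {..<m * n} (\<lambda>k. (\<Sum>j\<in>N t i. ?e t j k) / card (N t i)) =
        sqn {..<m * n} (?e (Suc t) i) +
        sqn {..<m * n} (\<lambda>k. (\<Sum>j\<in>N t i. ?e t j k) / card (N t i) - ?e (Suc t) i k)"
      by simp
  next
    fix t :: nat and v :: "nat \<Rightarrow> real" assume t: "1 \<le> t"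
    let ?v = "vec (m * n) v"
    have "?v \<bullet> ?v \<le> C * (\<Sum>j<m. (?v - (z t j - s)) \<bullet> (?v - (z t j - s)))"
      using C(2) ker[OF t] by simp
    moreover have "?v \<bullet> ?v = sqn {..<m * n} v" by (rule self_scalar_prod_eq_sqn) auto
    moreover have "(?v - (z t j - s)) \<bullet> (?v - (z t j - s)) = sqn {..<m * n} (\<lambda>k. v k - ?e t j k)"
      if "j < m" for j
      by (rule self_scalar_prod_eq_sqn) (use z[OF t that] s in auto)
    ultimately show "sqn {..<m * n} v \<le> C * (\<Sum>j<m. sqn {..<m * n} (\<lambda>k. v k - ?e t j k))"
      by simp
  qed (use C m_pos N in auto)
  obtain c r where cr: "0 \<le> c" "0 < r" "r < 1"
    "\<And>t i. 1 \<le> t \<Longrightarrow> i < m \<Longrightarrow> sqn {..<m * n} (?e t i) \<le> c * r ^ t"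
    using exponential_decay[OF rep] by blast
  have "(z t i - s) \<bullet> (z t i - s) \<le> c * r ^ t" if "1 \<le> t" "i < m" for t i
    using cr(4)[OF that] self_scalar_prod_eq_sqn[OF _ refl, of "z t i - s" "m * n"] z[OF that] s
    by simp
  then show ?thesis using cr(1-3) by blast
qed

end

section \<open>From the error bound and the tree to the final statement\<close>

lemma vec_first_error_le:
  fixes u v :: "real vec"
  assumes "u \<in> carrier_vec d" "v \<in> carrier_vec d" "n \<le> d"
  shows "(vec_first u n - vec_first v n) \<bullet> (vec_first u n - vec_first v n) \<le> (u - v) \<bullet> (u - v)"
proof -
  have "(vec_first u n - vec_first v n) \<bullet> (vec_first u n - vec_first v n)
      = (\<Sum>k<n. (u $ k - v $ k)\<^sup>2)"
    by (subst self_scalar_prod[of _ n]) (auto simp: vec_first_def)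
  also have "\<dots> \<le> (\<Sum>k<d. (u $ k - v $ k)\<^sup>2)"
    using assms by (intro sum_mono2) auto
  also have "\<dots> = (u - v) \<bullet> (u - v)"
    using assms by (subst self_scalar_prod[of _ d]) auto
  finally show ?thesis .
qed

text \<open>Squared norms decaying at rate \<open>r\<close> give norms decaying at rate
  \<open>sqrt r\<close>.\<close>

lemma converges_exponentiallyI:
  assumes "0 \<le> c" "0 < r" "r < 1" and "\<And>t. 1 \<le> t \<Longrightarrow> (x t - l) \<bullet> (x t - l) \<le> c * r ^ t"
  shows "converges_exponentially x l"
  unfolding converges_exponentially_def
proof (intro exI conjI allI impI)
  show "0 < sqrt r" "sqrt r < 1" using assms by auto
  fix t :: nat assume "1 \<le> t"
  then have "euclid_norm (x t - l) \<le> sqrt (c * r ^ t)"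
    unfolding euclid_norm_def using assms by simp
  then show "euclid_norm (x t - l) \<le> sqrt c * sqrt r ^ t"
    by (simp add: real_sqrt_mult real_sqrt_power)
qed

text \<open>Reachability is stated in the symmetrization of \<open>T\<close> because connectedness
  is defined through it. As \<open>T\<close> is itself the symmetrization of \<open>D\<close>, each
  arc there is an arc of \<open>D\<close> in one of its two directions.\<close>

lemma oriented_tree_arcs:
  fixes T :: "nat pair_pre_digraph" and D :: "(nat, nat) pre_digraph"
  assumes T: "tree_graph T" and verts: "pverts T = {..<m}"
    and D: "orientation_of D T" and arcs: "arcs D = {..<m - 1}"
  shows "k < m - 1 \<Longrightarrow> head D k < m" "k < m - 1 \<Longrightarrow> tail D k < m"
    and "k < m - 1 \<Longrightarrow> head D k \<noteq> tail D k"
    and "i < m \<Longrightarrow> (0, i) \<in> rtrancl_on {..<m} (parcs (mk_symmetric (with_proj T)))"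
    and "(u, v) \<in> parcs (mk_symmetric (with_proj T)) \<Longrightarrow>
      \<exists>k<m - 1. (u = tail D k \<and> v = head D k) \<or> (u = head D k \<and> v = tail D k)"
proof -
  have TD: "T = mk_symmetric D" and wf: "wf_digraph D"
    using D by (auto simp: orientation_of_def)
  have arc: "(tail D k, head D k) \<in> parcs T" if "k < m - 1" for k
    using that arcs by (auto simp: TD mk_symmetric_def)
  interpret pair_graph T using T by (simp add: tree_graph_def)
  show "head D k < m" "tail D k < m" "head D k \<noteq> tail D k" if "k < m - 1"
    using in_arcsD1[OF arc[OF that]] in_arcsD2[OF arc[OF that]] pair_no_loops[OF arc[OF that]]
    unfolding verts by simp_all
  have "strongly_connected (mk_symmetric (with_proj T))"
    using T by (simp add: tree_graph_def connected_def)
  moreover have "pverts (mk_symmetric (with_proj T)) = {..<m}"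
    using verts by (simp add: mk_symmetric_def)
  ultimately have "\<forall>u\<in>{..<m}. \<forall>v\<in>{..<m}. (u, v) \<in> rtrancl_on {..<m} (parcs (mk_symmetric (with_proj T)))"
    by (simp add: strongly_connected_def reachable_def)
  from this[rule_format, of 0 i] show "(0, i) \<in> rtrancl_on {..<m} (parcs (mk_symmetric (with_proj T)))" if "i < m"
    using that by simp
  show "\<exists>k<m - 1. (u = tail D k \<and> v = head D k) \<or> (u = head D k \<and> v = tail D k)"
    if "(u, v) \<in> parcs (mk_symmetric (with_proj T))"
  proof -
    have "(u, v) \<in> parcs T \<or> (v, u) \<in> parcs T" using that by (auto simp: mk_symmetric_def)
    then have "(u, v) \<in> parcs (mk_symmetric D) \<or> (v, u) \<in> parcs (mk_symmetric D)"
      unfolding TD .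
    then show ?thesis unfolding mk_symmetric_def arcs by auto
  qed
qed

theorem mainTheorem7:
  fixes m n :: nat
    and ni :: "nat \<Rightarrow> nat"
    and Ai :: "nat \<Rightarrow> real mat" and bi :: "nat \<Rightarrow> real vec"
    and A :: "real mat" and b :: "real vec"
    and T :: "nat pair_pre_digraph" and D :: "(nat, nat) pre_digraph"
    and H :: "real mat"
    and Mi :: "nat \<Rightarrow> real mat" and M :: "real mat" and q :: "real vec"
  assumes "m > 1" and "n \<ge> 1"
    and "\<And>i. i < m \<Longrightarrow> Ai i \<in> carrier_mat (ni i) n"
    and "\<And>i. i < m \<Longrightarrow> full_column_rank (Ai i)"
    and "\<And>i. i < m \<Longrightarrow> bi i \<in> carrier_vec (ni i)"
    and "A = stack_mats n (map Ai [0..<m])"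
    and "b = stack_vecs (map bi [0..<m])"
    and "tree_graph T" and "pverts T = {..<m}"
    and "orientation_of D T" and "arcs D = {..<m - 1}"
    and "H = incidence_matrix m (m - 1) D"
    and "\<And>i. i < m \<Longrightarrow> Mi i = ((Ai i)\<^sup>T * Ai i) @\<^sub>c (mat_of_row (row H i) \<otimes>\<^sub>k 1\<^sub>m n)"
    and "M = stack_mats (m * n) (map Mi [0..<m])"
    and "q = stack_vecs (map (\<lambda>i. (Ai i)\<^sup>T *\<^sub>v bi i) [0..<m])"
  shows
    "((\<exists>z\<in>carrier_vec (m * n). M *\<^sub>v z = q) \<and>
      (\<forall>z\<in>carrier_vec (m * n). M *\<^sub>v z = q \<longrightarrow>
         A\<^sup>T *\<^sub>v (A *\<^sub>v vec_first z n) = A\<^sup>T *\<^sub>v b))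
     \<and>
     (\<exists>!x. least_squares_solution A b x) \<and>
     (\<forall>(P :: nat \<Rightarrow> real mat) (N :: nat \<Rightarrow> nat \<Rightarrow> nat set) (z :: nat \<Rightarrow> nat \<Rightarrow> real vec) x.
        (\<forall>i<m. orth_projection_mat (m * n) (mat_kernel (Mi i)) (P i)) \<and>
        (\<forall>t\<ge>1. \<forall>i<m. N t i \<subseteq> {..<m} \<and> i \<in> N t i) \<and>
        repeatedly_jointly_strongly_connected (\<lambda>t. neighbor_graph m (N t)) \<and>
        (\<forall>t\<ge>1. \<forall>i<m. z t i \<in> carrier_vec (m * n)) \<and>
        (\<forall>i<m. Mi i *\<^sub>v z 1 i = (Ai i)\<^sup>T *\<^sub>v bi i) \<and>
        (\<forall>t\<ge>1. \<forall>i<m.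
           z (t + 1) i = z t i -
             (1 / real (card (N t i))) \<cdot>\<^sub>v
               (P i *\<^sub>v (real (card (N t i)) \<cdot>\<^sub>v z t i
                         - finsum_vec TYPE(real) (m * n) (\<lambda>j. z t j) (N t i)))) \<and>
        least_squares_solution A b x
        \<longrightarrow> (\<forall>i<m. converges_exponentially (\<lambda>t. vec_first (z t i) n) x))"
proof -
  note arcs = oriented_tree_arcs[OF assms(8-11)]
  have col: "(\<Sum>i<m. H $$ (i, k)) = 0" if "k < m - 1" for k
    unfolding assms(12) using arcs(1-3)[OF that] that by (intro incidence_matrix_col_sum)
  have walks: "\<exists>y. \<forall>j<m. (\<Sum>k<m - 1. H $$ (j, k) * y k)
      = (if j = i then 1 else 0) - (if j = (0::nat) then 1 else (0::real))" if "i < m" for i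
    unfolding assms(12) by (rule incidence_matrix_walk[OF arcs(4)[OF that] arcs(5) arcs(3)])
  interpret L: coupled_least_squares m n ni Ai bi H Mi
  proof
    show "H \<in> carrier_mat m (m - 1)" by (simp add: assms(12) incidence_matrix_def)
    show "w k = 0" if "\<And>i. i < m \<Longrightarrow> (\<Sum>k<m - 1. H $$ (i, k) * w k) = 0" "k < m - 1" for w k
      by (rule injective_of_walk_vectors[OF walks that])
  qed (use assms(1) assms(3-5) assms(13) col in auto)
  have defs: "A = L.A" "b = L.b" "M = L.M" "q = L.q"
    by (simp_all add: L.A_def L.b_def L.M_def L.q_def assms)
  obtain s where s: "s \<in> carrier_vec (m * n)" "L.M *\<^sub>v s = L.q" using L.M_solvable by blast
  have ls: "least_squares_solution L.A L.b (vec_first s n)"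
    using L.M_solution_normal_equation[OF s] L.A_carrier by (simp add: least_squares_solution_def)
  have nd: "n \<le> m * n" using assms(1) by simp
  have conv: "\<forall>i<m. converges_exponentially (\<lambda>t. vec_first (z t i) n) x"
    if h: "(\<forall>i<m. orth_projection_mat (m * n) (mat_kernel (Mi i)) (P i)) \<and>
        (\<forall>t\<ge>1. \<forall>i<m. N t i \<subseteq> {..<m} \<and> i \<in> N t i) \<and>
        repeatedly_jointly_strongly_connected (\<lambda>t. neighbor_graph m (N t)) \<and>
        (\<forall>t\<ge>1. \<forall>i<m. z t i \<in> carrier_vec (m * n)) \<and>
        (\<forall>i<m. Mi i *\<^sub>v z 1 i = (Ai i)\<^sup>T *\<^sub>v bi i) \<and>
        (\<forall>t\<ge>1. \<forall>i<m.
           z (t + 1) i = z t i -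
             (1 / real (card (N t i))) \<cdot>\<^sub>v
               (P i *\<^sub>v (real (card (N t i)) \<cdot>\<^sub>v z t i
                         - finsum_vec TYPE(real) (m * n) (\<lambda>j. z t j) (N t i)))) \<and>
        least_squares_solution L.A L.b x"
    for P :: "nat \<Rightarrow> real mat" and N :: "nat \<Rightarrow> nat \<Rightarrow> nat set" and z :: "nat \<Rightarrow> nat \<Rightarrow> real vec" and x
  proof -
    \<comment> \<open>By uniqueness the given least squares solution is the leading part of
      \<open>s\<close>, whose error bound is already available.\<close>
    have x: "x = vec_first s n" using h ls L.least_squares_unique_solution by blast
    have "\<exists>c r. 0 \<le> c \<and> 0 < r \<and> r < 1 \<and>
        (\<forall>t\<ge>1. \<forall>i<m. (z t i - s) \<bullet> (z t i - s) \<le> c * r ^ t)"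
      by (rule L.error_decay[of P N z, OF _ _ _ _ _ _ s]) (use h in auto)
    then obtain c r where cr: "0 \<le> c" "0 < r" "r < 1"
      "\<And>t i. 1 \<le> t \<Longrightarrow> i < m \<Longrightarrow> (z t i - s) \<bullet> (z t i - s) \<le> c * r ^ t" by blast
    show ?thesis
    proof (intro allI impI)
      fix i assume i: "i < m"
      show "converges_exponentially (\<lambda>t. vec_first (z t i) n) x"
      proof (rule converges_exponentiallyI[OF cr(1-3)])
        fix t :: nat assume t: "1 \<le> t"
        have "z t i \<in> carrier_vec (m * n)" using h t i by blast
        from vec_first_error_le[OF this s(1) nd] cr(4)[OF t i]
        show "(vec_first (z t i) n - x) \<bullet> (vec_first (z t i) n - x) \<le> c * r ^ t"
          unfolding x by linarith
      qed
    qed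
  qed
  show ?thesis
    unfolding defs
  proof (intro conjI)
    show "\<exists>z\<in>carrier_vec (m * n). L.M *\<^sub>v z = L.q" by (rule L.M_solvable)
    show "\<forall>z\<in>carrier_vec (m * n). L.M *\<^sub>v z = L.q \<longrightarrow>
        L.A\<^sup>T *\<^sub>v (L.A *\<^sub>v vec_first z n) = L.A\<^sup>T *\<^sub>v L.b"
      using L.M_solution_normal_equation by blast
    show "\<exists>!x. least_squares_solution L.A L.b x" by (rule L.least_squares_unique_solution)
  qed (rule allI, rule allI, rule allI, rule allI, rule impI, rule conv, assumption)
qed

end
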